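(* Let $\{e_i: i=1,\dots,d\}$ be the canonical basis of $\mathbb{R}^d$. Let $f$ be a real valued measurable function defined in an open set $U\subset\mathbb{R}^d$. Then $f$ is differentiable at almost every point $x\in U$ where the following two conditions hold: $$\limsup_{t\in\mathbb{R},\,t\to 0}\left|\frac{f(x+te_i)-f(x)}{t}\right|<\infty,\qquad i=1,\dots,d,$$ and $$\limsup_{h\in\mathbb{R}^d,\,|h|\to 0}|\Delta_2(f)(x,h)|<\infty.$$
   Context: For $h\in\mathbb{R}^d\setminus\{0\}$ with $x-h,x,x+h\in U$, $\Delta_2(f)(x,h)=\frac{f(x+h)+f(x-h)-2f(x)}{2|h|}$. "Almost every" refers to Lebesgue measure in $\mathbb{R}^d$. *)

theory Defs
  imports "HOL-Analysis.Analysis"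
begin

text \<open>
  The quotient is used only for \<open>h \<noteq> 0\<close> with \<open>x - h\<close>, \<open>x\<close>, \<open>x + h\<close> in the open domain of \<open>f\<close>.
  For \<open>x\<close> in that domain this holds for all small \<open>h \<noteq> 0\<close>, so a limit superior along \<open>at 0\<close>
  does not depend on the values of the total function \<open>f\<close> elsewhere.
\<close>

definition Delta2 :: "(real ^ 'n \<Rightarrow> real) \<Rightarrow> real ^ 'n \<Rightarrow> real ^ 'n \<Rightarrow> real" where
  "Delta2 f x h = (f (x + h) + f (x - h) - 2 * f x) / (2 * norm h)"

end

theory Submission
  imports Defs
begin

text \<open>
  By Stepanov's theorem it is enough to show that, at almost every point \<open>x\<close> where both conditions hold,
  \<open>f (x + h) - f x = O(|h|)\<close>.

  By Lusin's theorem one may restrict to a compact set \<open>K\<close> on which \<open>f\<close> is continuous, and to the set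
  \<open>A\<close> of those points of \<open>K\<close> at which both conditions hold with a fixed constant at a fixed scale. \<open>A\<close> may be
  non-measurable, so let \<open>x \<in> A\<close> be an outer density point of \<open>A\<close>. The set \<open>P \<supseteq> A\<close> given by the
  coordinate condition within \<open>K\<close> is measurable. For most small \<open>v\<close> all points obtained from \<open>x + v\<close> by changing
  signs of coordinates of \<open>v\<close> lie in \<open>P\<close>; changing the signs one at a time gives
  \<open>f (x + v) - f (x - v) = O(|v|)\<close>, and with the second difference at \<open>x\<close> also
  \<open>f (x + v) - f x = O(|v|)\<close>. For an arbitrary \<open>h\<close> choose \<open>z \<in> A\<close> near \<open>x\<close> such that both \<open>z - x\<close>
  and \<open>2 (z - x) - h\<close> are such vectors; the second difference at \<open>z\<close> relates \<open>f (x + h)\<close> to \<open>f\<close> at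
  \<open>z\<close> and at \<open>2 z - x - h\<close>.

  Stepanov's theorem follows from Rademacher's by McShane extension and comparison at outer density
  points.
\<close>

subsection \<open>Outer density points\<close>

text \<open>Sums a comparison made on single Vitali balls over the whole disjoint selection. Two
  measures are allowed so that Lebesgue measure can also be compared with a Stieltjes
  measure.\<close>

lemma scaled_emeasure_UN_mono:
  assumes "countable I" "\<And>i. i \<in> I \<Longrightarrow> X i \<in> sets M" "\<And>i. i \<in> I \<Longrightarrow> Y i \<in> sets N"
    and "disjoint_family_on X I" "disjoint_family_on Y I"
    and "\<And>i. i \<in> I \<Longrightarrow> a * emeasure M (X i) \<le> b * emeasure N (Y i)"
  shows "a * emeasure M (\<Union>i\<in>I. X i) \<le> b * emeasure N (\<Union>i\<in>I. Y i)"
proof -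
  have "a * emeasure M (\<Union>i\<in>I. X i) = (\<integral>\<^sup>+i. a * emeasure M (X i) \<partial>count_space I)"
    using assms by (simp add: emeasure_UN_countable nn_integral_cmult)
  also have "\<dots> \<le> (\<integral>\<^sup>+i. b * emeasure N (Y i) \<partial>count_space I)"
    using assms(6) by (intro nn_integral_mono) simp
  also have "\<dots> = b * emeasure N (\<Union>i\<in>I. Y i)"
    using assms by (simp add: emeasure_UN_countable nn_integral_cmult)
  finally show ?thesis .
qed

text \<open>
  Applying the hypothesis to an open set of almost minimal measure among the sets covering \<open>S\<close> up to
  a null set shows that this minimal measure is zero. No measurability of \<open>S\<close> is needed.
\<close>

lemma negligible_if_contracting:
  fixes S :: "'a::euclidean_space set"
  assumes "bounded S" and \<kappa>: "0 \<le> \<kappa>" "\<kappa> < 1"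
    and shrink: "\<And>V. \<lbrakk>open V; S \<subseteq> V; V \<in> lmeasurable\<rbrakk> \<Longrightarrow>
      \<exists>W \<in> lmeasurable. negligible (S - W) \<and> measure lebesgue W \<le> \<kappa> * measure lebesgue V"
  shows "negligible S"
proof -
  define \<T> where "\<T> = {T \<in> lmeasurable. negligible (S - T)}"
  define s where "s = (INF T\<in>\<T>. measure lebesgue T)"
  obtain a where "S \<subseteq> cball 0 a"
    using bounded_subset_ballD[OF \<open>bounded S\<close>, of 0] ball_subset_cball by (metis subset_trans)
  then have "cball 0 a \<in> \<T>"
    unfolding \<T>_def by (simp add: Diff_eq_empty_iff[THEN iffD2])
  then have ne: "\<T> \<noteq> {}"
    by blast
  have bdd: "bdd_below (measure lebesgue ` \<T>)"
    by (rule bdd_belowI[of _ 0]) auto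
  have lower: "s \<le> measure lebesgue T" if "T \<in> \<T>" for T
    unfolding s_def using bdd that by (rule cINF_lower)
  have approx: "\<exists>T\<in>\<T>. measure lebesgue T < s + e" if "e > 0" for e
    using cINF_less_iff[OF ne bdd, of "s + e"] that by (simp add: s_def)
  \<comment> \<open>The null set \<open>S - T\<close> is Lebesgue measurable even if
    \<open>S\<close> is not, so adding it turns an almost-cover into a true cover of the same
    measure.\<close>
  have fill: "T \<union> (S - T) \<in> lmeasurable" "measure lebesgue (T \<union> (S - T)) = measure lebesgue T"
    if "T \<in> \<T>" for T
    using that unfolding \<T>_def
    by (auto simp del: Un_Diff_cancel simp: negligible_imp_measurable negligible_iff_null_sets measure_Un_null_set fmeasurableD)
  have "s \<le> \<kappa> * s + e" if "e > 0" for e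
  proof -
    obtain T where T: "T \<in> \<T>" "measure lebesgue T < s + e / 2"
      using approx[of "e / 2"] \<open>e > 0\<close> half_gt_zero by blast
    define H where "H = T \<union> (S - T)"
    have H: "H \<in> lmeasurable" "measure lebesgue H < s + e / 2"
      using fill[OF T(1)] T(2) by (auto simp: H_def)
    obtain V where V: "open V" "H \<subseteq> V" "V - H \<in> lmeasurable" "emeasure lebesgue (V - H) < ennreal (e / 2)"
      by (rule sets_lebesgue_outer_open[OF fmeasurableD[OF H(1)] half_gt_zero[OF \<open>e > 0\<close>]])
    have VH: "V = H \<union> (V - H)"
      using V(2) by blast
    have Vm: "V \<in> lmeasurable"
      using fmeasurable.Un[OF H(1) V(3)] VH by simp
    have "measure lebesgue (V - H) < e / 2"
      using V(3,4) \<open>e > 0\<close> by (simp add: emeasure_eq_measure2 ennreal_less_iff)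
    moreover have "measure lebesgue V \<le> measure lebesgue H + measure lebesgue (V - H)"
      using measure_Un_le[of H lebesgue "V - H"] H(1) V(3) VH by (simp add: fmeasurableD)
    ultimately have "measure lebesgue V \<le> s + e"
      using H(2) by linarith
    moreover obtain W where W: "W \<in> \<T>" "measure lebesgue W \<le> \<kappa> * measure lebesgue V"
      using shrink[OF V(1) _ Vm] V(2) by (auto simp: \<T>_def H_def)
    ultimately have "s \<le> \<kappa> * (s + e)"
      using lower[OF W(1)] \<kappa>(1) by (meson mult_left_mono order_trans)
    moreover have "\<kappa> * e \<le> e"
      using \<kappa> \<open>e > 0\<close> by simp
    ultimately show ?thesis
      by (simp add: algebra_simps)
  qed
  then have "s \<le> \<kappa> * s"
    by (rule field_le_epsilon)
  then have "s \<le> 0"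
    using \<kappa>(2) by (simp add: mult_le_cancel_right1)
  show "negligible S"
    unfolding negligible_outer
  proof (intro allI impI)
    fix e :: real assume "e > 0"
    then obtain T where T: "T \<in> \<T>" "measure lebesgue T < e"
      using approx[of e] \<open>s \<le> 0\<close> by force
    show "\<exists>T. S \<subseteq> T \<and> T \<in> lmeasurable \<and> measure lebesgue T < e"
      using fill[OF T(1)] T(2) by (intro exI[of _ "T \<union> (S - T)"]) auto
  qed
qed

text \<open>Balls that leave \<open>V\<close> can be discarded because arbitrarily small ones remain
  at each point. Spheres are null, so the open balls still cover almost all of \<open>S\<close>;
  their union is open, which allows a second Vitali selection inside it.\<close>

lemma Vitali_cballs_in_open:
  fixes a :: "'i \<Rightarrow> 'a::euclidean_space"
  assumes "open V" "S \<subseteq> V"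
    and fine: "\<forall>x\<in>S. \<forall>d>0. \<exists>i\<in>K. x \<in> cball (a i) (r i) \<and> 0 < r i \<and> r i < d"
  shows "\<exists>C. countable C \<and> C \<subseteq> K \<and> disjoint_family_on (\<lambda>i. cball (a i) (r i)) C \<and>
    (\<forall>i\<in>C. 0 < r i \<and> cball (a i) (r i) \<subseteq> V) \<and> negligible (S - (\<Union>i\<in>C. ball (a i) (r i)))"
proof -
  define K' where "K' = {i \<in> K. 0 < r i \<and> cball (a i) (r i) \<subseteq> V}"
  have fine': "\<exists>i. i \<in> K' \<and> x \<in> cball (a i) (r i) \<and> r i < d" if "x \<in> S" "0 < d" for x d
  proof -
    obtain e where e: "e > 0" "ball x e \<subseteq> V"
      using assms(1,2) \<open>x \<in> S\<close> open_contains_ball by blast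
    \<comment> \<open>The point \<open>x\<close> need not be the centre: a ball of radius below
      \<open>e / 2\<close> containing \<open>x\<close> lies within distance \<open>e\<close> of
      it.\<close>
    obtain i where i: "i \<in> K" "x \<in> cball (a i) (r i)" "0 < r i" "r i < min d (e / 2)"
      using fine[rule_format, OF \<open>x \<in> S\<close>, of "min d (e / 2)"] \<open>0 < d\<close> e(1) by auto
    have "cball (a i) (r i) \<subseteq> ball x e"
    proof
      fix y assume "y \<in> cball (a i) (r i)"
      then show "y \<in> ball x e"
        using i(2,4) dist_triangle[of x y "a i"] by (simp add: dist_commute)
    qed
    then show ?thesis
      using i e(2) by (auto simp: K'_def)
  qed
  obtain C where C: "countable C" "C \<subseteq> K'"
    "pairwise (\<lambda>i j. disjnt (cball (a i) (r i)) (cball (a j) (r j))) C"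
    "negligible (S - (\<Union>i\<in>C. cball (a i) (r i)))"
    using Vitali_covering_theorem_cballs[of K' r S a] fine' by (auto simp: K'_def)
  show ?thesis
  proof (intro exI conjI)
    have "negligible (\<Union>i\<in>C. sphere (a i) (r i))"
      using C(1) by (intro negligible_countable_Union) (auto simp: negligible_sphere)
    moreover have "S - (\<Union>i\<in>C. ball (a i) (r i)) \<subseteq> (S - (\<Union>i\<in>C. cball (a i) (r i))) \<union> (\<Union>i\<in>C. sphere (a i) (r i))"
    proof
      fix y assume y: "y \<in> S - (\<Union>i\<in>C. ball (a i) (r i))"
      show "y \<in> (S - (\<Union>i\<in>C. cball (a i) (r i))) \<union> (\<Union>i\<in>C. sphere (a i) (r i))"
      proof (cases "\<exists>i\<in>C. y \<in> cball (a i) (r i)")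
        case True
        then obtain i where i: "i \<in> C" "y \<in> cball (a i) (r i)" by blast
        then have "y \<in> sphere (a i) (r i)"
          using y by (auto simp: not_less)
        then show ?thesis
          using i(1) by blast
      qed (use y in blast)
    qed
    ultimately show "negligible (S - (\<Union>i\<in>C. ball (a i) (r i)))"
      using C(4) by (meson negligible_subset negligible_Un)
    show "disjoint_family_on (\<lambda>i. cball (a i) (r i)) C"
      using C(3) by (auto simp: disjoint_family_on_def pairwise_def disjnt_def)
  qed (use C(1,2) in \<open>auto simp: K'_def\<close>)
qed

lemma measure_lebesgue_cball:
  "0 \<le> r \<Longrightarrow> measure lebesgue (cball c r :: 'a::euclidean_space set) = unit_ball_vol (real DIM('a)) * r ^ DIM('a)"
  using content_cball[of r c] by (simp add: measure_completion)

lemma measure_lebesgue_cball_pos: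
  "0 < r \<Longrightarrow> 0 < measure lebesgue (cball c r :: 'a::euclidean_space set)"
  by (simp add: measure_lebesgue_cball)

text \<open>
  Since \<open>A\<close> may be non-measurable, density is expressed through the measurable sets \<open>T\<close> avoiding
  \<open>A\<close>: near an outer density point they occupy a vanishing proportion of small balls.
\<close>

definition misses_part :: "'a::euclidean_space set \<Rightarrow> real \<Rightarrow> 'a \<Rightarrow> real \<Rightarrow> bool" where
  "misses_part A \<epsilon> x r \<longleftrightarrow> (\<exists>T\<in>lmeasurable. T \<subseteq> cball x r \<and> T \<inter> A = {} \<and>
     \<epsilon> * measure lebesgue (cball x r) \<le> measure lebesgue T)"

definition outer_density_point :: "'a::euclidean_space set \<Rightarrow> 'a \<Rightarrow> bool" where
  "outer_density_point A x \<longleftrightarrow> (\<forall>\<epsilon>>0. \<exists>\<delta>>0. \<forall>r. 0 < r \<longrightarrow> r < \<delta> \<longrightarrow> \<not> misses_part A \<epsilon> x r)"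

lemma misses_part_antimono:
  assumes "misses_part B \<epsilon>' x r" "A \<subseteq> B" "\<epsilon> \<le> \<epsilon>'"
  shows "misses_part A \<epsilon> x r"
proof -
  obtain T where T: "T \<in> lmeasurable" "T \<subseteq> cball x r" "T \<inter> B = {}"
     "\<epsilon>' * measure lebesgue (cball x r) \<le> measure lebesgue T"
    using assms(1) by (auto simp: misses_part_def)
  have "\<epsilon> * measure lebesgue (cball x r) \<le> \<epsilon>' * measure lebesgue (cball x r)"
    using assms(3) by (intro mult_right_mono) auto
  with T assms(2) show ?thesis
    unfolding misses_part_def by (intro bexI[of _ T]) auto
qed

lemma misses_part_le_1:
  assumes "misses_part A \<epsilon> x r" "0 < r"
  shows "\<epsilon> \<le> 1"
proof -
  obtain T where T: "T \<in> lmeasurable" "T \<subseteq> cball x r" "\<epsilon> * measure lebesgue (cball x r) \<le> measure lebesgue T"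
    using assms(1) by (auto simp: misses_part_def)
  have "measure lebesgue T \<le> measure lebesgue (cball x r)"
    using T by (intro measure_mono_fmeasurable) auto
  then have "\<epsilon> * measure lebesgue (cball x r) \<le> 1 * measure lebesgue (cball x r)"
    using T(3) by linarith
  then show ?thesis
    using measure_lebesgue_cball_pos[OF assms(2), of x] mult_le_cancel_right by (metis less_le_not_le)
qed

text \<open>The balls witnessing a missed proportion form a Vitali cover of the exceptional set.
  Removing the missed sets from the selected balls loses no point of \<open>A\<close> and leaves at
  most the fraction \<open>1 - \<epsilon>\<close> of the measure of \<open>V\<close>, so the
  contraction criterion applies.\<close>

lemma negligible_misses_part:
  fixes A :: "'a::euclidean_space set"
  assumes "bounded A" "0 < \<epsilon>"
  shows "negligible {x \<in> A. \<forall>\<delta>>0. \<exists>r>0. r < \<delta> \<and> misses_part A \<epsilon> x r}"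
proof -
  define S where "S = {x \<in> A. \<forall>\<delta>>0. \<exists>r>0. r < \<delta> \<and> misses_part A \<epsilon> x r}"
  have "negligible S"
  proof (cases "\<epsilon> \<le> 1")
    \<comment> \<open>The contraction factor \<open>1 - \<epsilon>\<close> must be nonnegative. For
      larger \<open>\<epsilon>\<close> no subset of a ball can have the required measure.\<close>
    case False
    then have "S = {}"
      using misses_part_le_1 zero_less_one unfolding S_def by blast
    then show ?thesis
      by simp
  next
    case True
    show ?thesis
    proof (rule negligible_if_contracting[of _ "1 - \<epsilon>"])
      show "bounded S"
        using assms(1) by (rule bounded_subset) (auto simp: S_def)
      fix V :: "'a set" assume V: "open V" "S \<subseteq> V" "V \<in> lmeasurable"
      \<comment> \<open>Each index carries its missed set \<open>T\<close>, so selecting a ball also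
        selects a witness.\<close>
      define K where "K = {(x, r, T). 0 < r \<and> T \<in> lmeasurable \<and> T \<subseteq> cball x r \<and>
       \<epsilon> * measure lebesgue (cball x r) \<le> measure lebesgue T \<and> T \<inter> A = {}}"
      have fine: "\<forall>x\<in>S. \<forall>d>0. \<exists>i\<in>K. x \<in> cball (fst i) (fst (snd i)) \<and> 0 < fst (snd i) \<and> fst (snd i) < d"
      proof (intro ballI allI impI)
        fix x and d :: real assume xd: "x \<in> S" "0 < d"
        obtain r T where "0 < r" "r < d" "T \<in> lmeasurable" "T \<subseteq> cball x r"
          "\<epsilon> * measure lebesgue (cball x r) \<le> measure lebesgue T" "T \<inter> A = {}"
          using xd unfolding S_def misses_part_def by blast
        then show "\<exists>i\<in>K. x \<in> cball (fst i) (fst (snd i)) \<and> 0 < fst (snd i) \<and> fst (snd i) < d"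
          by (intro bexI[of _ "(x, r, T)"]) (auto simp: K_def)
      qed
      obtain C where C: "countable C" "C \<subseteq> K" "disjoint_family_on (\<lambda>i. cball (fst i) (fst (snd i))) C"
        "\<forall>i\<in>C. 0 < fst (snd i) \<and> cball (fst i) (fst (snd i)) \<subseteq> V"
        "negligible (S - (\<Union>i\<in>C. ball (fst i) (fst (snd i))))"
        using Vitali_cballs_in_open[where a = fst and r = "\<lambda>i. fst (snd i)", OF V(1,2) fine] by (elim exE conjE)
      let ?B = "\<lambda>i::'a \<times> real \<times> 'a set. cball (fst i) (fst (snd i))"
      let ?T = "\<lambda>i::'a \<times> real \<times> 'a set. snd (snd i)"
      define D where "D = (\<Union>i\<in>C. ?B i)"
      define E where "E = (\<Union>i\<in>C. ?T i)"
      have K: "?T i \<in> lmeasurable" "?T i \<subseteq> ?B i" "\<epsilon> * measure lebesgue (?B i) \<le> measure lebesgue (?T i)" "?T i \<inter> A = {}"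
        if "i \<in> C" for i
        using subsetD[OF C(2) that] by (simp_all add: K_def case_prod_beta)
      have Ts: "?T i \<in> sets lebesgue" if "i \<in> C" for i
        using K(1)[OF that] by (rule fmeasurableD)
      have DV: "D \<subseteq> V" and ED: "E \<subseteq> D"
        using C(4) K(2) unfolding D_def E_def by blast+
      have Dm: "D \<in> lmeasurable"
        using DV V(3) C(1) by (intro fmeasurableI2[OF V(3)]) (auto simp: D_def intro!: sets.countable_UN'')
      have Em: "E \<in> lmeasurable"
        using C(1) Ts ED by (intro fmeasurableI2[OF Dm]) (auto simp: E_def intro!: sets.countable_UN'')
      have disjT: "disjoint_family_on ?T C"
        using C(3) K(2) unfolding disjoint_family_on_def by blast
      have "ennreal \<epsilon> * emeasure lebesgue D \<le> 1 * emeasure lebesgue E"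
        unfolding D_def E_def using C(1) _ _ C(3) disjT
      proof (rule scaled_emeasure_UN_mono)
        fix i assume "i \<in> C"
        then show "ennreal \<epsilon> * emeasure lebesgue (?B i) \<le> 1 * emeasure lebesgue (?T i)"
          using K(1,3)[OF \<open>i \<in> C\<close>] assms(2)
          by (simp add: emeasure_eq_measure2 ennreal_leI flip: ennreal_mult)
      qed (use Ts in auto)
      then have "\<epsilon> * measure lebesgue D \<le> measure lebesgue E"
        using Dm Em assms(2) by (simp add: emeasure_eq_measure2 flip: ennreal_mult)
      moreover have "measure lebesgue (D - E) = measure lebesgue D - measure lebesgue E"
        using Dm Em ED by (simp add: measurable_measure_Diff fmeasurableD)
      moreover have "measure lebesgue D \<le> measure lebesgue V"
        using DV Dm V(3) by (simp add: measure_mono_fmeasurable fmeasurableD)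
      moreover have D_le: "(1 - \<epsilon>) * measure lebesgue D \<le> (1 - \<epsilon>) * measure lebesgue V"
        using True calculation(3) by (intro mult_left_mono) auto
      ultimately have le: "measure lebesgue (D - E) \<le> (1 - \<epsilon>) * measure lebesgue V"
        by (simp add: left_diff_distrib)
      have "S \<subseteq> A"
        by (auto simp: S_def)
      then have "S \<inter> E = {}"
        unfolding E_def using K(4) by blast
      moreover have "(\<Union>i\<in>C. ball (fst i) (fst (snd i))) \<subseteq> D"
        unfolding D_def by (intro UN_mono order_refl ball_subset_cball)
      ultimately have "S - (D - E) \<subseteq> S - (\<Union>i\<in>C. ball (fst i) (fst (snd i)))"
        by blast
      then have "negligible (S - (D - E))"
        by (rule negligible_subset[OF C(5)])
      with le show "\<exists>W\<in>lmeasurable. negligible (S - W) \<and> measure lebesgue W \<le> (1 - \<epsilon>) * measure lebesgue V"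
        using fmeasurable_Diff[OF Dm fmeasurableD[OF Em]] by blast
    qed (use True assms(2) in auto)
  qed
  then show ?thesis
    by (simp only: S_def)
qed

lemma outer_density_point_mono:
  "outer_density_point A x \<Longrightarrow> A \<subseteq> B \<Longrightarrow> outer_density_point B x"
  unfolding outer_density_point_def by (meson misses_part_antimono order_refl)

text \<open>A form of Lebesgue's density theorem for arbitrary sets. Cutting \<open>A\<close> by
  balls gives bounded pieces, and rational proportions \<open>1 / real (Suc n)\<close> make the
  exceptional sets countable in number; a density point of a piece is one of
  \<open>A\<close>.\<close>

theorem negligible_not_outer_density_point:
  fixes A :: "'a::euclidean_space set"
  shows "negligible {x \<in> A. \<not> outer_density_point A x}"
proof -
  define B where "B m = A \<inter> cball 0 (real m)" for m
  define S where "S m n = {x \<in> B m. \<forall>\<delta>>0. \<exists>r>0. r < \<delta> \<and> misses_part (B m) (1 / real (Suc n)) x r}" for m n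
  have neg: "negligible (\<Union>m. \<Union>n. S m n)"
    unfolding S_def by (intro negligible_Union_nat negligible_misses_part) (auto simp: B_def intro: bounded_Int)
  have "x \<in> (\<Union>m. \<Union>n. S m n)" if x: "x \<in> A" "\<not> outer_density_point A x" for x
  proof -
    obtain m where m: "norm x \<le> real m"
      using real_arch_simple by blast
    have "\<not> outer_density_point (B m) x"
      using x(2) outer_density_point_mono[of "B m" x A] by (auto simp: B_def)
    then obtain \<epsilon> where \<epsilon>: "\<epsilon> > 0" "\<And>\<delta>. \<delta> > 0 \<Longrightarrow> \<exists>r>0. r < \<delta> \<and> misses_part (B m) \<epsilon> x r"
      unfolding outer_density_point_def by metis
    obtain n where n: "1 / real (Suc n) < \<epsilon>"
      using nat_approx_posE[OF \<epsilon>(1)] by blast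
    have "\<exists>r>0. r < \<delta> \<and> misses_part (B m) (1 / real (Suc n)) x r" if "\<delta> > 0" for \<delta>
      using \<epsilon>(2)[OF that] misses_part_antimono[OF _ order_refl less_imp_le[OF n]] by blast
    moreover have "x \<in> B m"
      using x(1) m by (simp add: B_def)
    ultimately have "x \<in> S m n"
      unfolding S_def by blast
    then show ?thesis
      by blast
  qed
  then have "{x \<in> A. \<not> outer_density_point A x} \<subseteq> (\<Union>m. \<Union>n. S m n)"
    by blast
  then show ?thesis
    using neg negligible_subset by blast
qed

text \<open>A ball of radius \<open>\<epsilon> * r\<close> around \<open>y\<close> free of points of
  \<open>A\<close> would lie in \<open>cball x ((1 + \<epsilon>) * r)\<close> and occupy the fixed
  proportion \<open>(\<epsilon> / (1 + \<epsilon>)) ^ DIM('a)\<close> of it.\<close>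

lemma outer_density_point_approx:
  fixes A :: "'a::euclidean_space set"
  assumes "outer_density_point A x" "0 < \<epsilon>"
  obtains \<delta> where "0 < \<delta>" "\<And>r y. \<lbrakk>0 < r; r < \<delta>; dist x y \<le> r\<rbrakk> \<Longrightarrow> \<exists>a\<in>A. dist a y \<le> \<epsilon> * r"
proof -
  let ?\<epsilon> = "(\<epsilon> / (1 + \<epsilon>)) ^ DIM('a)"
  have "?\<epsilon> > 0"
    using assms(2) by simp
  then obtain \<delta> where \<delta>: "\<delta> > 0" "\<And>r. \<lbrakk>0 < r; r < \<delta>\<rbrakk> \<Longrightarrow> \<not> misses_part A ?\<epsilon> x r"
    using assms(1) unfolding outer_density_point_def by metis
  show thesis
  proof
    show "\<delta> / (1 + \<epsilon>) > 0"
      using \<delta>(1) assms(2) by simp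
    fix r y assume r: "0 < r" "r < \<delta> / (1 + \<epsilon>)" "dist x y \<le> r"
    let ?R = "(1 + \<epsilon>) * r"
    have "cball y (\<epsilon> * r) \<subseteq> cball x ?R"
    proof
      fix z assume "z \<in> cball y (\<epsilon> * r)"
      then show "z \<in> cball x ?R"
        using r(3) dist_triangle[of x z y] by (simp add: algebra_simps)
    qed
    moreover have "?\<epsilon> * measure lebesgue (cball x ?R) = measure lebesgue (cball y (\<epsilon> * r))"
    proof -
      have "(\<epsilon> / (1 + \<epsilon>)) ^ DIM('a) * ((1 + \<epsilon>) * r) ^ DIM('a) = (\<epsilon> * r) ^ DIM('a)"
        using assms(2) by (simp flip: power_mult_distrib)
      moreover have "0 \<le> ?R" "0 \<le> \<epsilon> * r"
        using assms(2) r(1) by auto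
      ultimately show ?thesis
        unfolding measure_lebesgue_cball[OF \<open>0 \<le> ?R\<close>] measure_lebesgue_cball[OF \<open>0 \<le> \<epsilon> * r\<close>]
        by (simp add: mult.left_commute)
    qed
    moreover have "\<not> misses_part A ?\<epsilon> x ?R"
    proof (rule \<delta>(2))
      show "0 < ?R" "?R < \<delta>"
        using r assms(2) by (simp_all add: pos_less_divide_eq mult.commute)
    qed
    ultimately have "cball y (\<epsilon> * r) \<inter> A \<noteq> {}"
      unfolding misses_part_def by (metis lmeasurable_cball order_refl)
    then show "\<exists>a\<in>A. dist a y \<le> \<epsilon> * r"
      by (auto simp: dist_commute)
  qed
qed

subsection \<open>Lipschitz functions are differentiable almost everywhere\<close>

text \<open>If the lower and upper limits differed, two rationals would fit strictly between them;
  the bounds exclude infinite limits. Rational levels leave only countably many exceptional sets to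
  estimate.\<close>

lemma convergent_if_not_oscillating:
  fixes f :: "'b \<Rightarrow> real"
  assumes "F \<noteq> bot" and bounds: "\<forall>\<^sub>F t in F. a \<le> f t" "\<forall>\<^sub>F t in F. f t \<le> b"
    and osc: "\<And>p q::rat. p < q \<Longrightarrow> \<not> ((\<exists>\<^sub>F t in F. f t < of_rat p) \<and> (\<exists>\<^sub>F t in F. of_rat q < f t))"
  shows "\<exists>l. (f \<longlongrightarrow> l) F"
proof -
  let ?f = "\<lambda>t. ereal (f t)"
  have le: "Liminf F ?f \<le> Limsup F ?f"
    using \<open>F \<noteq> bot\<close> by (rule Liminf_le_Limsup)
  have ge: "Limsup F ?f \<le> Liminf F ?f"
  proof (rule ccontr)
    assume "\<not> ?thesis"
    then obtain p where p: "Liminf F ?f < ereal (of_rat p)" "ereal (of_rat p) < Limsup F ?f"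
      using ereal_dense3 by (meson not_le)
    obtain q where q: "ereal (of_rat p) < ereal (of_rat q)" "ereal (of_rat q) < Limsup F ?f"
      using ereal_dense3[OF p(2)] by blast
    have "\<exists>\<^sub>F t in F. f t < of_rat p"
      using p(1) Liminf_bounded[of "ereal (of_rat p)" ?f F]
      by (auto simp: frequently_def not_less)
    moreover have "\<exists>\<^sub>F t in F. of_rat q < f t"
      using q(2) Limsup_bounded[of ?f "ereal (of_rat q)" F]
      by (auto simp: frequently_def not_less)
    ultimately show False
      using osc[of p q] q(1) by (simp add: of_rat_less)
  qed
  have "ereal a \<le> Liminf F ?f"
    using bounds(1) by (intro Liminf_bounded) simp
  moreover have "Limsup F ?f \<le> ereal b"
    using bounds(2) by (intro Limsup_bounded) simp
  ultimately obtain l where "Liminf F ?f = ereal l" "Limsup F ?f = ereal l"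
    using le ge by (cases "Liminf F ?f"; cases "Limsup F ?f") auto
  then have "(?f \<longlongrightarrow> ereal l) F"
    using tendsto_iff_Liminf_eq_Limsup[OF \<open>F \<noteq> bot\<close>] by blast
  then show ?thesis
    by auto
qed

text \<open>
  Vitali's theorem is used twice: first for intervals of slope below \<open>p\<close>, then, inside their union,
  for intervals of slope above \<open>q\<close>; comparing Lebesgue and Stieltjes measure gives the factor \<open>p / q\<close>.
\<close>

lemma negligible_oscillating_quotients:
  fixes G :: "real \<Rightarrow> real"
  assumes "mono G" "continuous_on UNIV G" "bounded S" "0 \<le> p" "p < q"
    and lower: "\<And>x. x \<in> S \<Longrightarrow> \<exists>\<^sub>F t in at 0. (G (x + t) - G x) / t < p"
    and upper: "\<And>x. x \<in> S \<Longrightarrow> \<exists>\<^sub>F t in at 0. q < (G (x + t) - G x) / t"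
  shows "negligible S"
proof (rule negligible_if_contracting[of _ "p / q"])
  define \<mu> where "\<mu> = interval_measure G"
  have sets_\<mu>: "sets \<mu> = sets borel"
    by (simp add: \<mu>_def)
  \<comment> \<open>Continuity of \<open>G\<close> excludes atoms, so closed intervals have the
    increment of \<open>G\<close> as their measure.\<close>
  have \<mu>_cball: "emeasure \<mu> (cball c r) = ennreal (G (c + r) - G (c - r))" if "0 < r" for c r
    using emeasure_interval_measure_Icc[of "c - r" "c + r" G] assms(1,2) that
    by (simp add: \<mu>_def cball_eq_atLeastAtMost monoD)
  have leb_cball: "emeasure lborel (cball c r) = ennreal (2 * r)" if "0 < r" for c r :: real
    using that by (simp add: cball_eq_atLeastAtMost)
  \<comment> \<open>For either sign of \<open>t\<close>, the interval between \<open>x\<close> and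
    \<open>x + t\<close> is the closed ball about \<open>x + t / 2\<close>, and the quotient at
    \<open>x\<close> is the slope of \<open>G\<close> across it.\<close>
  have interval: "\<exists>c r. x \<in> cball c r \<and> 0 < r \<and> r < d \<and> P ((G (c + r) - G (c - r)) / (2 * r))"
    if freq: "\<exists>\<^sub>F t in at 0. P ((G (x + t) - G x) / t)" and "0 < d" for x d P
  proof -
    have "\<forall>\<^sub>F t in at (0::real). \<bar>t\<bar> < d \<and> t \<noteq> 0"
      using \<open>0 < d\<close> by (auto simp: eventually_at intro!: exI[of _ d])
    then obtain t where t: "P ((G (x + t) - G x) / t)" "\<bar>t\<bar> < d" "t \<noteq> 0"
      using frequently_eventually_conj[OF freq] frequently_ex by (smt (verit))
    have eq: "(G (x + t / 2 + \<bar>t\<bar> / 2) - G (x + t / 2 - \<bar>t\<bar> / 2)) / (2 * (\<bar>t\<bar> / 2)) = (G (x + t) - G x) / t"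
    proof (cases "t > 0")
      case True
      then have "x + t / 2 + \<bar>t\<bar> / 2 = x + t" "x + t / 2 - \<bar>t\<bar> / 2 = x" "2 * (\<bar>t\<bar> / 2) = t"
        by auto
      then show ?thesis by (simp only:)
    next
      case False
      then have "x + t / 2 + \<bar>t\<bar> / 2 = x" "x + t / 2 - \<bar>t\<bar> / 2 = x + t" "2 * (\<bar>t\<bar> / 2) = - t"
        by auto
      then show ?thesis by (metis minus_diff_eq minus_divide_divide)
    qed
    have "x \<in> cball (x + t / 2) (\<bar>t\<bar> / 2) \<and> 0 < \<bar>t\<bar> / 2 \<and> \<bar>t\<bar> / 2 < d"
      using t by (simp add: dist_real_def)
    with t(1) eq show ?thesis
      by metis
  qed
  fix V :: "real set" assume V: "open V" "S \<subseteq> V" "V \<in> lmeasurable"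
  define K1 where "K1 = {(c, r). 0 < r \<and> (G (c + r) - G (c - r)) / (2 * r) < p}"
  have fine1: "\<forall>x\<in>S. \<forall>d>0. \<exists>i\<in>K1. x \<in> cball (fst i) (snd i) \<and> 0 < snd i \<and> snd i < d"
    using interval[OF lower] by (force simp: K1_def)
  obtain C1 where C1: "countable C1" "C1 \<subseteq> K1" "disjoint_family_on (\<lambda>i. cball (fst i) (snd i)) C1"
      "\<forall>i\<in>C1. 0 < snd i \<and> cball (fst i) (snd i) \<subseteq> V" "negligible (S - (\<Union>i\<in>C1. ball (fst i) (snd i)))"
    using Vitali_cballs_in_open[where a = fst and r = snd, OF V(1,2) fine1] by (elim exE conjE)
  define D where "D = (\<Union>i\<in>C1. ball (fst i) (snd i))"
  define K2 where "K2 = {(c, r). 0 < r \<and> q < (G (c + r) - G (c - r)) / (2 * r)}"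
  have fine2: "\<forall>x\<in>S \<inter> D. \<forall>d>0. \<exists>i\<in>K2. x \<in> cball (fst i) (snd i) \<and> 0 < snd i \<and> snd i < d"
    using interval[OF upper] by (force simp: K2_def)
  have D: "open D" "S \<inter> D \<subseteq> D"
    by (auto simp: D_def)
  obtain C2 where C2: "countable C2" "C2 \<subseteq> K2" "disjoint_family_on (\<lambda>i. cball (fst i) (snd i)) C2"
      "\<forall>i\<in>C2. 0 < snd i \<and> cball (fst i) (snd i) \<subseteq> D" "negligible (S \<inter> D - (\<Union>i\<in>C2. ball (fst i) (snd i)))"
    using Vitali_cballs_in_open[where a = fst and r = snd, OF D fine2] by (elim exE conjE)
  define W1 where "W1 = (\<Union>i\<in>C1. cball (fst i) (snd i))"
  define W where "W = (\<Union>i\<in>C2. cball (fst i) (snd i))"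
  have borel: "W1 \<in> sets borel" "W \<in> sets borel"
    using C1(1) C2(1) by (auto simp: W1_def W_def intro!: sets.countable_UN'')
  have "W \<subseteq> D"
    using C2(4) by (auto simp: W_def)
  moreover have "D \<subseteq> W1"
    unfolding D_def W1_def by (intro UN_mono order_refl ball_subset_cball)
  ultimately have "W \<subseteq> W1" by blast
  have "W1 \<subseteq> V"
    using C1(4) by (auto simp: W1_def)
  \<comment> \<open>With |.| for Lebesgue measure, the chain is q|W| \<le> \<mu>(W) \<le> \<mu>(W1)
    \<le> p|W1| \<le> p|V|.\<close>
  have "ennreal q * emeasure lborel W \<le> 1 * emeasure \<mu> W"
    unfolding W_def using C2(1) _ _ C2(3) C2(3)
  proof (rule scaled_emeasure_UN_mono)
    fix i assume i: "i \<in> C2"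
    then have "0 < snd i" "q < (G (fst i + snd i) - G (fst i - snd i)) / (2 * snd i)"
      using C2(2) by (auto simp: K2_def)
    then show "ennreal q * emeasure lborel (cball (fst i) (snd i)) \<le> 1 * emeasure \<mu> (cball (fst i) (snd i))"
      using assms(4,5) by (simp add: \<mu>_cball leb_cball pos_less_divide_eq ennreal_leI flip: ennreal_mult)
  qed (auto simp: sets_\<mu>)
  also have "\<dots> \<le> 1 * emeasure \<mu> W1"
    using \<open>W \<subseteq> W1\<close> borel sets_\<mu> by (simp add: emeasure_mono)
  also have "\<dots> \<le> ennreal p * emeasure lborel W1"
    unfolding W1_def using C1(1) _ _ C1(3) C1(3)
  proof (rule scaled_emeasure_UN_mono)
    fix i assume i: "i \<in> C1"
    then have "0 < snd i" "(G (fst i + snd i) - G (fst i - snd i)) / (2 * snd i) < p"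
      using C1(2) by (auto simp: K1_def)
    then show "1 * emeasure \<mu> (cball (fst i) (snd i)) \<le> ennreal p * emeasure lborel (cball (fst i) (snd i))"
      using assms(4,5) by (simp add: \<mu>_cball leb_cball pos_divide_less_eq ennreal_leI flip: ennreal_mult)
  qed (auto simp: sets_\<mu>)
  also have "\<dots> \<le> ennreal p * emeasure lborel V"
    using \<open>W1 \<subseteq> V\<close> V(1) by (intro mult_left_mono emeasure_mono) auto
  finally have le: "ennreal q * emeasure lborel W \<le> ennreal p * emeasure lborel V" .
  have WV: "W \<subseteq> V"
    using \<open>W \<subseteq> W1\<close> \<open>W1 \<subseteq> V\<close> by blast
  then have Wm: "W \<in> lmeasurable"
    using V(3) borel(2) by (intro fmeasurableI2[OF V(3)]) auto
  have "emeasure lborel W = ennreal (measure lebesgue W)" "emeasure lborel V = ennreal (measure lebesgue V)"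
    using emeasure_eq_measure2[OF Wm] emeasure_eq_measure2[OF V(3)] V(1) borel(2) by simp_all
  with le have "q * measure lebesgue W \<le> p * measure lebesgue V"
    using assms(4,5) by (simp flip: ennreal_mult)
  then have "measure lebesgue W \<le> p / q * measure lebesgue V"
    using assms(4,5) by (simp add: field_simps)
  moreover have "negligible (S - W)"
  proof (rule negligible_subset[OF negligible_Un[OF C1(5) C2(5)]])
    have "(\<Union>i\<in>C2. ball (fst i) (snd i)) \<subseteq> W"
      unfolding W_def by (intro UN_mono order_refl ball_subset_cball)
    then show "S - W \<subseteq> (S - (\<Union>i\<in>C1. ball (fst i) (snd i))) \<union> (S \<inter> D - (\<Union>i\<in>C2. ball (fst i) (snd i)))"
      unfolding D_def by blast
  qed
  ultimately show "\<exists>W\<in>lmeasurable. negligible (S - W) \<and> measure lebesgue W \<le> p / q * measure lebesgue V"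
    using Wm by blast
qed (use assms in \<open>auto simp: field_simps\<close>)

text \<open>Adding \<open>L * x\<close> makes \<open>g\<close> monotone and moves its quotients into
  the interval from 0 to \<open>2 * L\<close>. Where they fail to converge they oscillate across two
  rational levels, which happens only on a null set.\<close>

theorem negligible_not_differentiable_lipschitz_real:
  fixes g :: "real \<Rightarrow> real"
  assumes "L-lipschitz_on UNIV g"
  shows "negligible {x. \<nexists>l. ((\<lambda>t. (g (x + t) - g x) / t) \<longlongrightarrow> l) (at 0)}"
proof -
  define G where "G x = g x + L * x" for x
  have lip: "\<bar>g y - g x\<bar> \<le> L * \<bar>y - x\<bar>" for x y
    using lipschitz_onD[OF assms, of y x] by (simp add: dist_real_def)
  have "mono G"
  proof
    fix x y :: real assume "x \<le> y"
    then show "G x \<le> G y"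
      using lip[of y x] by (auto simp: G_def algebra_simps abs_if split: if_splits)
  qed
  have cont: "continuous_on UNIV G"
    unfolding G_def using lipschitz_on_continuous_on[OF assms] by (intro continuous_intros)
  have Q: "(G (x + t) - G x) / t = (g (x + t) - g x) / t + L" if "t \<noteq> 0" for x t
    using that by (simp add: G_def field_simps)
  have bounds: "\<bar>(g (x + t) - g x) / t\<bar> \<le> L" if "t \<noteq> 0" for x t
    using lip[of "x + t" x] that by (simp add: abs_divide pos_divide_le_eq)
  define S where "S p q m = {x \<in> cball 0 (real m). (\<exists>\<^sub>F t in at 0. (G (x + t) - G x) / t < of_rat p) \<and>
      (\<exists>\<^sub>F t in at 0. of_rat q < (G (x + t) - G x) / t)}" for p q m
  have "negligible (S p q m)" if "p < q" for p q m
  proof (cases "p < 0")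
    \<comment> \<open>A negative level is never crossed because the quotients of \<open>G\<close>
      are nonnegative; the oscillation lemma itself asks for \<open>0 \<le> p\<close>.\<close>
    case True
    have "\<forall>\<^sub>F t in at 0. \<not> (G (x + t) - G x) / t < of_rat p" for x
      unfolding eventually_at_filter
    proof (intro always_eventually allI impI)
      fix t :: real assume "t \<noteq> 0"
      then have "0 \<le> (G (x + t) - G x) / t"
        using bounds[of t x] Q[of t x] by linarith
      then show "\<not> (G (x + t) - G x) / t < of_rat p"
        using True by (smt (verit) of_rat_less_0_iff)
    qed
    then have "S p q m = {}"
      by (auto simp: S_def frequently_def)
    then show ?thesis by simp
  next
    case False
    have "bounded (S p q m)"
      by (rule bounded_subset[OF bounded_cball[of 0 "real m"]]) (auto simp: S_def)
    then show ?thesis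
      by (rule negligible_oscillating_quotients[OF \<open>mono G\<close> cont, of "S p q m" "of_rat p" "of_rat q"])
        (use that False in \<open>auto simp: S_def of_rat_less\<close>)
  qed
  then have neg: "negligible (\<Union>(p, q, m)\<in>{(p, q, m). p < q}. S p q m)"
    by (intro negligible_countable_Union) auto
  have "x \<in> (\<Union>(p, q, m)\<in>{(p, q, m). p < q}. S p q m)"
    if x: "\<nexists>l. ((\<lambda>t. (g (x + t) - g x) / t) \<longlongrightarrow> l) (at 0)" for x
  proof (rule ccontr)
    assume *: "\<not> ?thesis"
    obtain m where m: "\<bar>x\<bar> \<le> real m"
      using real_arch_simple by blast
    have "\<exists>l. ((\<lambda>t. (G (x + t) - G x) / t) \<longlongrightarrow> l) (at 0)"
    proof (rule convergent_if_not_oscillating[where a = 0 and b = "2 * L"])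
      have "\<forall>\<^sub>F t in at (0::real). t \<noteq> 0"
        by (simp add: eventually_at_filter)
      moreover have "0 \<le> (G (x + t) - G x) / t \<and> (G (x + t) - G x) / t \<le> 2 * L" if "t \<noteq> 0" for t
        using bounds[OF that, of x] Q[OF that, of x] by linarith
      ultimately show "\<forall>\<^sub>F t in at 0. 0 \<le> (G (x + t) - G x) / t" "\<forall>\<^sub>F t in at 0. (G (x + t) - G x) / t \<le> 2 * L"
        by (auto elim: eventually_mono)
      show "\<not> ((\<exists>\<^sub>F t in at 0. (G (x + t) - G x) / t < of_rat p) \<and> (\<exists>\<^sub>F t in at 0. of_rat q < (G (x + t) - G x) / t))"
        if "p < q" for p q :: rat
        using * m that by (force simp: S_def)
    qed simp
    then obtain l where "((\<lambda>t. (G (x + t) - G x) / t) \<longlongrightarrow> l) (at 0)" ..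
    then have "((\<lambda>t. (G (x + t) - G x) / t - L) \<longlongrightarrow> l - L) (at 0)"
      by (intro tendsto_intros)
    then have "((\<lambda>t. (g (x + t) - g x) / t) \<longlongrightarrow> l - L) (at 0)"
      by (rule Lim_transform_eventually) (auto simp: eventually_at_filter Q intro!: always_eventually)
    with x show False by blast
  qed
  then show ?thesis
    using negligible_subset[OF neg] by (simp add: subset_iff)
qed

section \<open>From lines to several variables: Rademacher's theorem\<close>

text \<open>The Cauchy criterion avoids mention of the limit and quantifies over scales by natural
  numbers. This form is used to show that the set of points with a directional derivative is
  Borel.\<close>

lemma tendsto_at_0_iff_Cauchy:
  fixes f :: "real \<Rightarrow> real"
  shows "(\<exists>l. (f \<longlongrightarrow> l) (at 0)) \<longleftrightarrow>
    (\<forall>k. \<exists>m. \<forall>s\<in>{u. 0 < \<bar>u\<bar> \<and> \<bar>u\<bar> < 1 / real (Suc m)}. \<forall>t\<in>{u. 0 < \<bar>u\<bar> \<and> \<bar>u\<bar> < 1 / real (Suc m)}.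
        \<bar>f s - f t\<bar> \<le> 1 / real (Suc k))" (is "?lhs \<longleftrightarrow> ?rhs")
proof
  assume ?lhs
  then obtain l where l: "(f \<longlongrightarrow> l) (at 0)" ..
  show ?rhs
  proof
    fix k
    have "\<forall>\<^sub>F t in at 0. dist (f t) l < 1 / real (Suc k) / 2"
      using l by (rule tendstoD) simp
    then obtain d where d: "d > 0" "\<And>t. t \<noteq> 0 \<Longrightarrow> \<bar>t\<bar> < d \<Longrightarrow> dist (f t) l < 1 / real (Suc k) / 2"
      unfolding eventually_at by (auto simp: dist_real_def)
    obtain m where m: "1 / real (Suc m) < d"
      using nat_approx_posE[OF d(1)] by blast
    show "\<exists>m. \<forall>s\<in>{u. 0 < \<bar>u\<bar> \<and> \<bar>u\<bar> < 1 / real (Suc m)}. \<forall>t\<in>{u. 0 < \<bar>u\<bar> \<and> \<bar>u\<bar> < 1 / real (Suc m)}.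
        \<bar>f s - f t\<bar> \<le> 1 / real (Suc k)"
    proof (intro exI[of _ m] ballI)
      fix s t
      assume st: "s \<in> {u. 0 < \<bar>u\<bar> \<and> \<bar>u\<bar> < 1 / real (Suc m)}" "t \<in> {u. 0 < \<bar>u\<bar> \<and> \<bar>u\<bar> < 1 / real (Suc m)}"
      have "dist (f s) l < 1 / real (Suc k) / 2" "dist (f t) l < 1 / real (Suc k) / 2"
        using st m d(2)[of s] d(2)[of t] by simp_all
      then show "\<bar>f s - f t\<bar> \<le> 1 / real (Suc k)"
        using dist_triangle_half_l by (metis dist_real_def less_imp_le)
    qed
  qed
next
  assume R: ?rhs
  have "cauchy_filter (filtermap f (at 0))"
    unfolding cauchy_filter_metric_filtermap
  proof (intro allI impI)
    fix e :: real assume "e > 0"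
    obtain k where k: "1 / real (Suc k) < e"
      using nat_approx_posE[OF \<open>e > 0\<close>] by blast
    obtain m where m: "\<forall>s\<in>{u. 0 < \<bar>u\<bar> \<and> \<bar>u\<bar> < 1 / real (Suc m)}. \<forall>t\<in>{u. 0 < \<bar>u\<bar> \<and> \<bar>u\<bar> < 1 / real (Suc m)}.
        \<bar>f s - f t\<bar> \<le> 1 / real (Suc k)"
      using R by blast
    show "\<exists>P. eventually P (at 0) \<and> (\<forall>s t. P s \<and> P t \<longrightarrow> dist (f s) (f t) < e)"
    proof (intro exI conjI allI impI)
      show "\<forall>\<^sub>F t in at 0. 0 < \<bar>t\<bar> \<and> \<bar>t\<bar> < 1 / real (Suc m)"
        unfolding eventually_at by (intro exI[of _ "1 / real (Suc m)"]) auto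
      show "dist (f s) (f t) < e"
        if "(0 < \<bar>s\<bar> \<and> \<bar>s\<bar> < 1 / real (Suc m)) \<and> (0 < \<bar>t\<bar> \<and> \<bar>t\<bar> < 1 / real (Suc m))" for s t
        using bspec[OF bspec[OF m], of s t] that k by (simp add: dist_real_def)
    qed
  qed
  then obtain l where "filtermap f (at 0) \<le> nhds l"
    using cauchy_filter_complete_converges[of "filtermap f (at 0)" UNIV]
    by (auto simp: filtermap_bot_iff complete_UNIV)
  then show ?lhs
    unfolding filterlim_def by blast
qed

text \<open>
  Averaging the measure of the translates \<open>N - t v\<close> over \<open>0 \<le> t \<le> 1\<close> reduces this to Tonelli's theorem on
  a product with the real line, for every direction \<open>v\<close> and without a change of coordinates.
\<close>

lemma negligible_if_null_on_lines:
  fixes N :: "'a::euclidean_space set"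
  assumes N: "N \<in> sets borel" and lines: "\<And>x. negligible {t::real. x + t *\<^sub>R v \<in> N}"
  shows "negligible N"
proof -
  have [measurable]: "N \<in> sets borel" by (rule N)
  have shift: "(\<integral>\<^sup>+x. indicator N (x + t *\<^sub>R v) \<partial>lborel) = emeasure lborel N" for t
  proof -
    have "emeasure lborel N = (\<integral>\<^sup>+x. indicator N x \<partial>distr lborel borel ((+) (t *\<^sub>R v)))"
      by (simp add: lborel_distr_plus)
    also have "\<dots> = (\<integral>\<^sup>+x. indicator N (x + t *\<^sub>R v) \<partial>lborel)"
      by (subst nn_integral_distr) (auto simp: add.commute)
    finally show ?thesis by simp
  qed
  have null: "(\<integral>\<^sup>+t. indicator {0..1::real} t * indicator N (x + t *\<^sub>R v) \<partial>lborel) = 0" for x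
  proof -
    have "{t. x + t *\<^sub>R v \<in> N} \<in> null_sets lborel"
      using lines[of x] unfolding negligible_iff_null_sets
      by (subst (asm) null_sets_completion_iff) auto
    then have "AE t in lborel. x + t *\<^sub>R v \<notin> N"
      by (rule AE_I') auto
    then show ?thesis
      by (subst nn_integral_0_iff_AE) auto
  qed
  have "emeasure lborel N = (\<integral>\<^sup>+t. indicator {0..1::real} t * emeasure lborel N \<partial>lborel)"
    by (subst nn_integral_multc) auto
  also have "\<dots> = (\<integral>\<^sup>+t. (\<integral>\<^sup>+x. indicator {0..1} t * indicator N (x + t *\<^sub>R v) \<partial>lborel) \<partial>lborel)"
    by (simp add: nn_integral_cmult shift)
  also have "\<dots> = (\<integral>\<^sup>+x. (\<integral>\<^sup>+t. indicator {0..1::real} t * indicator N (x + t *\<^sub>R v) \<partial>lborel) \<partial>lborel)"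
    by (intro lborel_pair.Fubini') measurable
  finally have "emeasure lborel N = 0"
    by (simp add: null)
  then show ?thesis
    using N by (simp add: negligible_iff_null_sets null_sets_completionI null_setsI)
qed

text \<open>Along each line in direction \<open>v\<close>, \<open>F\<close> is a Lipschitz function
  of one variable, so the exceptional set is null on every such line. Tonelli's theorem then needs
  only that this set is Borel.\<close>

lemma negligible_no_directional_derivative_lipschitz:
  fixes F :: "'a::euclidean_space \<Rightarrow> real"
  assumes F: "L-lipschitz_on UNIV F"
  shows "negligible {x. \<nexists>l. ((\<lambda>t. (F (x + t *\<^sub>R v) - F x) / t) \<longlongrightarrow> l) (at 0)}"
proof -
  define q where "q t x = (F (x + t *\<^sub>R v) - F x) / t" for t x
  define C where "C k s t = {x. \<bar>q s x - q t x\<bar> \<le> 1 / real (Suc k)}" for k s t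
  have contF: "continuous_on UNIV F"
    by (rule lipschitz_on_continuous_on[OF F])
  have "continuous_on UNIV (q t)" for t
    unfolding q_def divide_inverse by (intro continuous_intros continuous_on_compose2[OF contF]) auto
  then have closed: "closed (C k s t)" for k s t
    unfolding C_def by (intro closed_Collect_le continuous_intros)
  let ?I = "\<lambda>m. {u::real. 0 < \<bar>u\<bar> \<and> \<bar>u\<bar> < 1 / real (Suc m)}"
  define N where "N = {x. \<nexists>l. ((\<lambda>t. q t x) \<longlongrightarrow> l) (at 0)}"
  have eq: "- N = (\<Inter>k. \<Union>m. \<Inter>s\<in>?I m. \<Inter>t\<in>?I m. C k s t)"
    unfolding N_def C_def tendsto_at_0_iff_Cauchy
    by (simp only: set_eq_iff Compl_iff mem_Collect_eq not_not INT_iff UN_iff ball_UNIV bex_UNIV simp_thms)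
  \<comment> \<open>The uncountable intersections over \<open>s\<close> and \<open>t\<close> are of
    closed sets; only \<open>k\<close> and \<open>m\<close> require the Borel operations, and they
    range over natural numbers.\<close>
  have "closed (\<Inter>s\<in>?I m. \<Inter>t\<in>?I m. C k s t)" for k m
    using closed by (intro closed_INT ballI)
  then have "- N \<in> sets borel"
    unfolding eq by (intro sets.countable_INT' sets.countable_UN' image_subsetI borel_closed) auto
  then have "N \<in> sets borel"
    by (metis borel_comp double_complement)
  moreover have "negligible {t. x + t *\<^sub>R v \<in> N}" for x
  proof -
    define g where "g t = F (x + t *\<^sub>R v)" for t
    have "(L * norm v)-lipschitz_on UNIV g"
    proof (rule lipschitz_onI)
      fix s t :: real
      have "dist (g s) (g t) \<le> L * dist (x + s *\<^sub>R v) (x + t *\<^sub>R v)"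
        unfolding g_def using F by (rule lipschitz_onD) auto
      also have "dist (x + s *\<^sub>R v) (x + t *\<^sub>R v) = norm v * dist s t"
        by (simp add: dist_norm abs_minus_commute flip: scaleR_left_diff_distrib)
      finally show "dist (g s) (g t) \<le> L * norm v * dist s t"
        by (simp add: mult.assoc)
    qed (use lipschitz_on_nonneg[OF F] in auto)
    then have "negligible {t. \<nexists>l. ((\<lambda>s. (g (t + s) - g t) / s) \<longlongrightarrow> l) (at 0)}"
      by (rule negligible_not_differentiable_lipschitz_real)
    then show ?thesis
      by (simp add: N_def q_def g_def scaleR_left_distrib add.assoc)
  qed
  ultimately have "negligible N"
    by (rule negligible_if_null_on_lines)
  then show ?thesis
    by (simp add: N_def q_def)
qed

text \<open>Walk from \<open>x\<close> to \<open>x + h\<close> one coordinate at a time. The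
  intermediate points stay within \<open>DIM('a) * norm h\<close> of \<open>x\<close>, and the
  errors of the steps add up.\<close>

lemma coordinate_steps_bound:
  fixes F :: "'a::euclidean_space \<Rightarrow> real" and E :: real
  assumes step: "\<And>y b. \<lbrakk>b \<in> Basis; norm (y - x) \<le> DIM('a) * norm h\<rbrakk> \<Longrightarrow>
      \<bar>F (y + (h \<bullet> b) *\<^sub>R b) - F y - (h \<bullet> b) * c b\<bar> \<le> E"
  shows "\<bar>F (x + h) - F x - (\<Sum>b\<in>Basis. (h \<bullet> b) * c b)\<bar> \<le> DIM('a) * E"
proof -
  have "\<bar>F (x + (\<Sum>b\<in>I. (h \<bullet> b) *\<^sub>R b)) - F x - (\<Sum>b\<in>I. (h \<bullet> b) * c b)\<bar> \<le> card I * E"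
    if "finite I" "I \<subseteq> Basis" for I
    using that
  proof (induction I rule: finite_induct)
    case (insert b I)
    define y where "y = x + (\<Sum>b\<in>I. (h \<bullet> b) *\<^sub>R b)"
    have "norm (y - x) \<le> (\<Sum>b\<in>I. norm ((h \<bullet> b) *\<^sub>R b))"
      unfolding y_def add_diff_cancel_left' by (rule norm_sum)
    also have "\<dots> \<le> (\<Sum>b\<in>I. norm h)"
      using insert.prems by (intro sum_mono) (auto simp: Basis_le_norm)
    also have "\<dots> \<le> DIM('a) * norm h"
      using insert.prems by (auto intro!: mult_right_mono card_mono)
    finally have "\<bar>F (y + (h \<bullet> b) *\<^sub>R b) - F y - (h \<bullet> b) * c b\<bar> \<le> E"
      using insert.prems by (intro step) auto
    moreover have "\<bar>F y - F x - (\<Sum>b\<in>I. (h \<bullet> b) * c b)\<bar> \<le> card I * E"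
      using insert by (simp add: y_def)
    moreover have eq: "x + (\<Sum>b\<in>insert b I. (h \<bullet> b) *\<^sub>R b) = y + (h \<bullet> b) *\<^sub>R b"
        "(\<Sum>b\<in>insert b I. (h \<bullet> b) * c b) = (h \<bullet> b) * c b + (\<Sum>b\<in>I. (h \<bullet> b) * c b)"
        "real (card (insert b I)) * E = E + card I * E"
      using insert.hyps by (simp_all add: y_def algebra_simps)
    ultimately show ?case
      unfolding eq by linarith
  qed simp
  from this[of Basis] show ?thesis
    by (simp add: euclidean_representation)
qed

text \<open>Partial derivatives at \<open>x\<close> alone do not control steps starting at other
  points. At an outer density point of a piece with uniform estimates, each intermediate point has a
  neighbour in the piece, and the Lipschitz condition pays for moving to it.\<close>

theorem negligible_not_differentiable_lipschitz:
  fixes F :: "'a::euclidean_space \<Rightarrow> real"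
  assumes F: "L-lipschitz_on UNIV F"
  shows "negligible {x. \<not> F differentiable (at x)}"
proof -
  let ?D = "real DIM('a)"
  have D: "?D \<ge> 1"
    using DIM_positive[where 'a='a] by linarith
  have L: "L \<ge> 0"
    by (rule lipschitz_on_nonneg[OF F])
  have lip: "\<bar>F y - F z\<bar> \<le> L * norm (y - z)" for y z
    using lipschitz_onD[OF F, of y z] by (simp add: dist_norm)
  define X where "X = {x. \<forall>b\<in>Basis. \<exists>l. ((\<lambda>t. (F (x + t *\<^sub>R b) - F x) / t) \<longlongrightarrow> l) (at 0)}"
  define l where "l x b = (SOME l. ((\<lambda>t. (F (x + t *\<^sub>R b) - F x) / t) \<longlongrightarrow> l) (at 0))" for x b
  have l: "((\<lambda>t. (F (x + t *\<^sub>R b) - F x) / t) \<longlongrightarrow> l x b) (at 0)" if "x \<in> X" "b \<in> Basis" for x b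
    using that unfolding l_def X_def by (metis (mono_tags, lifting) mem_Collect_eq someI_ex)
  have "- X = (\<Union>b\<in>Basis. {x. \<nexists>l. ((\<lambda>t. (F (x + t *\<^sub>R b) - F x) / t) \<longlongrightarrow> l) (at 0)})"
    by (auto simp: X_def)
  then have negX: "negligible (- X)"
    using negligible_no_directional_derivative_lipschitz[OF F] by (metis (no_types, lifting) finite_Basis finite_imageI imageE negligible_Union)
  \<comment> \<open>Countably many such pieces cover \<open>X\<close> for each \<open>\<epsilon>\<close>, which replaces the theorems of Egorov and Lusin.\<close>
  define G where "G \<epsilon> m q = {x \<in> X. \<forall>b\<in>Basis. \<bar>q b - l x b\<bar> \<le> \<epsilon> \<and>
      (\<forall>t. \<bar>t\<bar> < 1 / real (Suc m) \<longrightarrow> \<bar>F (x + t *\<^sub>R b) - F x - t * l x b\<bar> \<le> \<epsilon> * \<bar>t\<bar>)}"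
    for \<epsilon> :: real and m and q :: "'a \<Rightarrow> real"
  have cover: "\<exists>m. \<exists>q\<in>Basis \<rightarrow>\<^sub>E \<rat>. x \<in> G \<epsilon> m q" if "x \<in> X" "\<epsilon> > 0" for x \<epsilon>
  proof -
    have "\<forall>b\<in>Basis. \<exists>q\<in>\<rat>. \<bar>q - l x b\<bar> \<le> \<epsilon>"
    proof
      fix b :: 'a
      obtain q where "q \<in> \<rat>" "l x b < q" "q < l x b + \<epsilon>"
        using Rats_dense_in_real[of "l x b" "l x b + \<epsilon>"] \<open>\<epsilon> > 0\<close> by auto
      then show "\<exists>q\<in>\<rat>. \<bar>q - l x b\<bar> \<le> \<epsilon>"
        by (intro bexI[of _ q]) auto
    qed
    then obtain q where q: "\<And>b. b \<in> Basis \<Longrightarrow> q b \<in> \<rat> \<and> \<bar>q b - l x b\<bar> \<le> \<epsilon>"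
      by metis
    have "\<forall>b\<in>Basis. \<forall>\<^sub>F t in at 0. dist ((F (x + t *\<^sub>R b) - F x) / t) (l x b) < \<epsilon>"
      using l[OF \<open>x \<in> X\<close>] \<open>\<epsilon> > 0\<close> by (auto dest: tendstoD)
    then have "\<forall>\<^sub>F t in at 0. \<forall>b\<in>Basis. dist ((F (x + t *\<^sub>R b) - F x) / t) (l x b) < \<epsilon>"
      by (simp add: eventually_ball_finite)
    then obtain d where d: "d > 0" "\<And>t b. \<lbrakk>t \<noteq> 0; \<bar>t\<bar> < d; b \<in> Basis\<rbrakk> \<Longrightarrow>
        dist ((F (x + t *\<^sub>R b) - F x) / t) (l x b) < \<epsilon>"
      unfolding eventually_at by (auto simp: dist_real_def)
    obtain m where m: "1 / real (Suc m) < d"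
      using nat_approx_posE[OF d(1)] by blast
    have "\<bar>F (x + t *\<^sub>R b) - F x - t * l x b\<bar> \<le> \<epsilon> * \<bar>t\<bar>" if t: "\<bar>t\<bar> < 1 / real (Suc m)" "b \<in> Basis" for t b
    proof (cases "t = 0")
      case False
      have eq: "F (x + t *\<^sub>R b) - F x - t * l x b = t * ((F (x + t *\<^sub>R b) - F x) / t - l x b)"
        using False by (subst right_diff_distrib) simp
      have "\<bar>(F (x + t *\<^sub>R b) - F x) / t - l x b\<bar> \<le> \<epsilon>"
        using d(2)[OF False _ t(2)] t(1) m by (simp add: dist_real_def)
      then show ?thesis
        unfolding eq abs_mult mult.commute[of \<epsilon>] by (intro mult_left_mono) auto
    qed simp
    \<comment> \<open>Restriction fixes the values outside \<open>Basis\<close>, so that only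
      countably many rational functions \<open>q\<close> occur.\<close>
    then have "x \<in> G \<epsilon> m (restrict q Basis)"
      using q \<open>x \<in> X\<close> by (simp add: G_def)
    moreover have "restrict q Basis \<in> Basis \<rightarrow>\<^sub>E \<rat>"
      using q by auto
    ultimately show ?thesis
      by blast
  qed
  have approx: "\<exists>\<delta>>0. \<forall>h. norm h < \<delta> \<longrightarrow>
      \<bar>F (x + h) - F x - (\<Sum>b\<in>Basis. (h \<bullet> b) * l x b)\<bar> \<le> ?D * (3 + 2 * L) * \<epsilon> * norm h"
    if x: "x \<in> G \<epsilon> m q" "outer_density_point (G \<epsilon> m q) x" and "\<epsilon> > 0" for x \<epsilon> m q
  proof -
    \<comment> \<open>Intermediate points lie within \<open>?D * norm h\<close> of \<open>x\<close>;
      the proportion \<open>\<epsilon> / ?D\<close> of this radius is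
      \<open>\<epsilon> * norm h\<close>.\<close>
    have "\<epsilon> / ?D > 0"
      using \<open>\<epsilon> > 0\<close> D by simp
    then obtain \<delta> where \<delta>: "\<delta> > 0" "\<And>r y. \<lbrakk>0 < r; r < \<delta>; dist x y \<le> r\<rbrakk> \<Longrightarrow> \<exists>a\<in>G \<epsilon> m q. dist a y \<le> \<epsilon> / ?D * r"
      using outer_density_point_approx[OF x(2)] by metis
    define \<delta>' where "\<delta>' = min (\<delta> / ?D) (1 / real (Suc m))"
    have "\<delta>' > 0"
      using \<delta>(1) D by (simp add: \<delta>'_def)
    moreover have "\<bar>F (x + h) - F x - (\<Sum>b\<in>Basis. (h \<bullet> b) * l x b)\<bar> \<le> ?D * (3 + 2 * L) * \<epsilon> * norm h"
      if h: "norm h < \<delta>'" for h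
    proof (cases "h = 0")
      case False
      \<comment> \<open>The 3 consists of one error for the quotient at \<open>a\<close> and two for
        comparing \<open>l a b\<close> with \<open>l x b\<close> through \<open>q b\<close>;
        \<open>2 * L\<close> pays for replacing \<open>y\<close> by \<open>a\<close> at both ends of
        the step.\<close>
      have "\<bar>F (x + h) - F x - (\<Sum>b\<in>Basis. (h \<bullet> b) * l x b)\<bar> \<le> ?D * ((3 + 2 * L) * \<epsilon> * norm h)"
      proof (rule coordinate_steps_bound)
        fix y b :: 'a
        assume b: "b \<in> Basis" and y: "norm (y - x) \<le> ?D * norm h"
        have "?D * norm h < \<delta>"
          using h D by (simp add: \<delta>'_def field_simps)
        then obtain a where a: "a \<in> G \<epsilon> m q" "dist a y \<le> \<epsilon> / ?D * (?D * norm h)"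
          using \<delta>(2)[of "?D * norm h" y] y False D by (auto simp: dist_norm norm_minus_commute)
        have ay: "norm (a - y) \<le> \<epsilon> * norm h"
          using a(2) D by (simp add: dist_norm)
        define t where "t = h \<bullet> b"
        have t: "\<bar>t\<bar> \<le> norm h"
          using b by (simp add: t_def Basis_le_norm)
        have "\<bar>F (a + t *\<^sub>R b) - F a - t * l a b\<bar> \<le> \<epsilon> * \<bar>t\<bar>"
          using a(1) b t h by (simp add: G_def \<delta>'_def)
        also have "\<dots> \<le> \<epsilon> * norm h"
          using t \<open>\<epsilon> > 0\<close> by simp
        finally have 1: "\<bar>F (a + t *\<^sub>R b) - F a - t * l a b\<bar> \<le> \<epsilon> * norm h" .
        have close: "\<bar>q b - l a b\<bar> \<le> \<epsilon>" "\<bar>q b - l x b\<bar> \<le> \<epsilon>"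
          using a(1) x(1) b by (auto simp: G_def)
        then have "\<bar>l a b - l x b\<bar> \<le> 2 * \<epsilon>"
          by linarith
        then have "\<bar>t\<bar> * \<bar>l a b - l x b\<bar> \<le> norm h * (2 * \<epsilon>)"
          using t by (intro mult_mono) auto
        then have 2: "\<bar>t * l a b - t * l x b\<bar> \<le> 2 * (\<epsilon> * norm h)"
          by (simp add: abs_mult[symmetric] right_diff_distrib mult.commute mult.left_commute)
        have 3: "\<bar>F a - F y\<bar> \<le> L * (\<epsilon> * norm h)"
          using lip[of a y] mult_left_mono[OF ay L] by linarith
        have "norm ((a + t *\<^sub>R b) - (y + t *\<^sub>R b)) \<le> \<epsilon> * norm h"
          using ay by simp
        then have 4: "\<bar>F (a + t *\<^sub>R b) - F (y + t *\<^sub>R b)\<bar> \<le> L * (\<epsilon> * norm h)"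
          using lip[of "a + t *\<^sub>R b" "y + t *\<^sub>R b"] mult_left_mono[OF _ L] by (meson order_trans)
        have "(3 + 2 * L) * \<epsilon> * norm h = 3 * (\<epsilon> * norm h) + 2 * (L * (\<epsilon> * norm h))"
          by (simp add: algebra_simps)
        then show "\<bar>F (y + (h \<bullet> b) *\<^sub>R b) - F y - (h \<bullet> b) * l x b\<bar> \<le> (3 + 2 * L) * \<epsilon> * norm h"
          using 1 2 3 4 unfolding t_def[symmetric] by linarith
      qed
      then show ?thesis
        by (simp add: mult.assoc)
    qed simp
    ultimately show ?thesis
      by blast
  qed
  define B where "B = (\<Union>k. \<Union>m. \<Union>q\<in>Basis \<rightarrow>\<^sub>E \<rat>. {x \<in> G (1 / real (Suc k)) m q. \<not> outer_density_point (G (1 / real (Suc k)) m q) x})"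
  have "countable (Basis \<rightarrow>\<^sub>E (\<rat> :: real set) :: ('a \<Rightarrow> real) set)"
    by (intro countable_PiE) (auto simp: countable_rat)
  then have "negligible B"
    unfolding B_def by (intro negligible_Union_nat negligible_countable_Union) (auto simp: negligible_not_outer_density_point)
  moreover have "F differentiable (at x)" if "x \<in> X" "x \<notin> B" for x
  proof -
    define f' where "f' h = (\<Sum>b\<in>Basis. (h \<bullet> b) * l x b)" for h
    have "bounded_linear f'"
      unfolding f'_def by (intro bounded_linear_intros)
    moreover have "\<exists>d>0. \<forall>y. norm (y - x) < d \<longrightarrow> norm (F y - F x - f' (y - x)) \<le> e * norm (y - x)" if "e > 0" for e
    proof -
      have pos: "?D * (3 + 2 * L) > 0"
        using D L by simp
      then obtain k where k: "1 / real (Suc k) < e / (?D * (3 + 2 * L))"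
        using nat_approx_posE[of "e / (?D * (3 + 2 * L))"] \<open>e > 0\<close> by (metis divide_pos_pos)
      obtain m q where mq: "q \<in> Basis \<rightarrow>\<^sub>E \<rat>" "x \<in> G (1 / real (Suc k)) m q"
        using cover[OF \<open>x \<in> X\<close>, of "1 / real (Suc k)"] by auto
      then have dens: "outer_density_point (G (1 / real (Suc k)) m q) x"
        using \<open>x \<notin> B\<close> unfolding B_def by blast
      have "1 / real (Suc k) > 0"
        by simp
      from approx[OF mq(2) dens this, folded f'_def]
      obtain \<delta> where \<delta>: "\<delta> > 0" "\<forall>h. norm h < \<delta> \<longrightarrow> \<bar>F (x + h) - F x - f' h\<bar> \<le> ?D * (3 + 2 * L) * (1 / real (Suc k)) * norm h"
        by (elim exE conjE)
      have "?D * (3 + 2 * L) * (1 / real (Suc k)) \<le> e"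
        using k pos by (simp add: pos_less_divide_eq mult.commute del: of_nat_Suc)
      then have le: "?D * (3 + 2 * L) * (1 / real (Suc k)) * norm h \<le> e * norm h" for h :: 'a
        by (rule mult_right_mono) simp
      have "norm (F y - F x - f' (y - x)) \<le> e * norm (y - x)" if "norm (y - x) < \<delta>" for y
        using order_trans[OF \<delta>(2)[rule_format, OF that] le] by simp
      then show ?thesis
        using \<delta>(1) by blast
    qed
    ultimately show ?thesis
      unfolding differentiable_def has_derivative_at_alt by blast
  qed
  then have "{x. \<not> F differentiable (at x)} \<subseteq> - X \<union> B"
    by blast
  ultimately show ?thesis
    using negX negligible_Un negligible_subset by blast
qed

subsection \<open>Stepanov's theorem\<close>

text \<open>The extension is the infimum of the cones \<open>f a + L * dist x a\<close>. The
  Lipschitz condition on \<open>A\<close> keeps each of them above the downward cones at points of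
  \<open>A\<close>, so the infimum is finite and agrees with \<open>f\<close> on
  \<open>A\<close>.\<close>

lemma McShane_extension:
  fixes f :: "'a::metric_space \<Rightarrow> real"
  assumes f: "L-lipschitz_on A f"
  obtains F where "L-lipschitz_on UNIV F" "\<And>x. x \<in> A \<Longrightarrow> F x = f x"
proof (cases "A = {}")
  case True
  have "L-lipschitz_on UNIV (\<lambda>x::'a. 0::real)"
    using lipschitz_on_nonneg[OF f] by (intro lipschitz_onI) auto
  then show ?thesis
    using that True by blast
next
  case False
  have L: "L \<ge> 0"
    by (rule lipschitz_on_nonneg[OF f])
  define F where "F x = (INF a\<in>A. f a + L * dist x a)" for x
  have lower: "f b - L * dist x b \<le> f a + L * dist x a" if "a \<in> A" "b \<in> A" for a b x
  proof -
    have "f b - f a \<le> L * dist b a"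
      using lipschitz_onD[OF f \<open>b \<in> A\<close> \<open>a \<in> A\<close>] by (simp add: dist_real_def)
    also have "\<dots> \<le> L * (dist x b + dist x a)"
      using L dist_triangle3[of b a x] by (intro mult_left_mono) (auto simp: dist_commute)
    finally show ?thesis
      by (simp add: algebra_simps)
  qed
  have bdd: "bdd_below ((\<lambda>a. f a + L * dist x a) ` A)" for x
    using False lower by (metis (mono_tags, lifting) bdd_belowI2 all_not_in_conv)
  have F_le: "F x \<le> f a + L * dist x a" if "a \<in> A" for a x
    unfolding F_def by (rule cINF_lower[OF bdd that])
  have step: "F x \<le> F y + L * dist x y" for x y
  proof -
    have "F x - L * dist x y \<le> F y"
      unfolding F_def[of y]
    proof (rule cINF_greatest[OF False])
      fix a assume "a \<in> A"
      have "L * dist x a \<le> L * dist x y + L * dist y a"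
        using L dist_triangle[of x a y] by (metis distrib_left mult_left_mono)
      then show "F x - L * dist x y \<le> f a + L * dist y a"
        using F_le[OF \<open>a \<in> A\<close>, of x] by linarith
    qed
    then show ?thesis by linarith
  qed
  show ?thesis
  proof
    show "L-lipschitz_on UNIV F"
    proof (rule lipschitz_onI)
      show "dist (F x) (F y) \<le> L * dist x y" for x y
        using step[of x y] step[of y x] by (simp add: dist_real_def dist_commute abs_le_iff)
    qed (rule L)
    show "F x = f x" if "x \<in> A" for x
    proof (rule antisym)
      show "F x \<le> f x"
        using F_le[OF that, of x] by simp
      show "f x \<le> F x"
        unfolding F_def using lower[OF _ that, of _ x] by (intro cINF_greatest[OF False]) simp
    qed
  qed
qed

text \<open>\<open>f\<close> is Lipschitz on each \<open>A m\<close>, hence agrees there with a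
  function \<open>F m\<close> differentiable almost everywhere. Near an outer density point every
  \<open>y\<close> has a relatively close \<open>a\<close> in \<open>A m\<close>; both functions
  change little from \<open>a\<close> to \<open>y\<close>, so \<open>f\<close> inherits the
  derivative of \<open>F m\<close>.\<close>

theorem negligible_pointwise_lipschitz_not_differentiable:
  fixes f :: "'a::euclidean_space \<Rightarrow> real"
  shows "negligible {x. (\<exists>M. \<exists>\<delta>>0. \<forall>h. norm h < \<delta> \<longrightarrow> \<bar>f (x + h) - f x\<bar> \<le> M * norm h) \<and> \<not> f differentiable (at x)}"
proof -
  define A where "A m = {x. \<bar>f x\<bar> \<le> real (Suc m) \<and>
      (\<forall>h. norm h < 1 / real (Suc m) \<longrightarrow> \<bar>f (x + h) - f x\<bar> \<le> real (Suc m) * norm h)}" for m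
  \<comment> \<open>With n = m + 1, points closer than 1/n are handled by the constant n; for others
    |f| \<le> n gives a difference of at most 2n, which is 2n^2 times 1/n.\<close>
  define L where "L m = 2 * real (Suc m) * real (Suc m)" for m
  have L: "L m > 0" for m
    by (simp add: L_def)
  have lipA: "(L m)-lipschitz_on (A m) f" for m
  proof (rule lipschitz_onI)
    fix x y assume xy: "x \<in> A m" "y \<in> A m"
    let ?n = "real (Suc m)"
    have n: "?n \<ge> 1" by simp
    show "dist (f x) (f y) \<le> L m * dist x y"
    proof (cases "norm (x - y) < 1 / ?n")
      case True
      have "\<bar>f (y + (x - y)) - f y\<bar> \<le> ?n * norm (x - y)"
        using xy(2) True unfolding A_def by blast
      also have "?n \<le> L m"
        unfolding L_def using n mult_left_mono[of 1 "2 * ?n" ?n] by (simp add: mult.commute mult.left_commute)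
      finally show ?thesis
        by (simp add: dist_real_def dist_norm mult_right_mono)
    next
      case False
      have "\<bar>f x\<bar> \<le> ?n" "\<bar>f y\<bar> \<le> ?n"
        using xy unfolding A_def by blast+
      then have "\<bar>f x - f y\<bar> \<le> 2 * ?n"
        using abs_triangle_ineq4[of "f x" "f y"] by (simp only: mult_2 order_trans[OF _ add_mono])
      also have "\<dots> = L m * (1 / ?n)"
        by (simp add: L_def del: of_nat_Suc)
      also have "\<dots> \<le> L m * norm (x - y)"
        using False L[of m] by (intro mult_left_mono) auto
      finally show ?thesis
        by (simp add: dist_real_def dist_norm)
    qed
  qed (simp add: L_def)
  have "\<forall>m. \<exists>F. (L m)-lipschitz_on UNIV F \<and> (\<forall>x\<in>A m. F x = f x)"
    using McShane_extension[OF lipA] by metis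
  then obtain F where F: "\<And>m. (L m)-lipschitz_on UNIV (F m)" "\<And>m x. x \<in> A m \<Longrightarrow> F m x = f x"
    by metis
  define B where "B = (\<Union>m. {x \<in> A m. \<not> outer_density_point (A m) x} \<union> {x. \<not> F m differentiable (at x)})"
  have "negligible B"
    unfolding B_def by (intro negligible_Union_nat negligible_Un negligible_not_outer_density_point
        negligible_not_differentiable_lipschitz[OF F(1)])
  moreover have "f differentiable (at x)" if x: "x \<in> A m" "x \<notin> B" for x m
  proof -
    let ?n = "real (Suc m)"
    have dens: "outer_density_point (A m) x" and "F m differentiable (at x)"
      using x unfolding B_def by blast+
    then obtain F' where F': "bounded_linear F'" "\<And>e. e > 0 \<Longrightarrow> \<exists>d>0. \<forall>y. norm (y - x) < d \<longrightarrow>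
        norm (F m y - F m x - F' (y - x)) \<le> e * norm (y - x)"
      unfolding differentiable_def has_derivative_at_alt by blast
    have "\<exists>d>0. \<forall>y. norm (y - x) < d \<longrightarrow> norm (f y - f x - F' (y - x)) \<le> e * norm (y - x)" if "e > 0" for e
    proof -
      \<comment> \<open>\<open>k\<close> adds the growth rates of \<open>f\<close> at
        \<open>a\<close> and of \<open>F m\<close>; dividing \<open>e\<close> by
        \<open>2 * k\<close> leaves \<open>e / 2\<close> for the derivative of
        \<open>F m\<close>.\<close>
      define k where "k = ?n + L m"
      have k: "k > 0"
        using L[of m] by (simp add: k_def add_pos_pos)
      define \<epsilon> where "\<epsilon> = e / (2 * k)"
      have \<epsilon>: "\<epsilon> > 0" "k * \<epsilon> = e / 2"
        using \<open>e > 0\<close> k by (auto simp: \<epsilon>_def)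
      obtain d1 where d1: "d1 > 0" "\<And>y. norm (y - x) < d1 \<Longrightarrow> norm (F m y - F m x - F' (y - x)) \<le> e / 2 * norm (y - x)"
        using F'(2)[of "e / 2"] \<open>e > 0\<close> by auto
      obtain d2 where d2: "d2 > 0" "\<And>r y. \<lbrakk>0 < r; r < d2; dist x y \<le> r\<rbrakk> \<Longrightarrow> \<exists>a\<in>A m. dist a y \<le> \<epsilon> * r"
        using outer_density_point_approx[OF dens \<epsilon>(1)] by metis
      \<comment> \<open>The bound \<open>1 / (?n * \<epsilon>)\<close> brings \<open>y\<close>
        within the scale \<open>1 / ?n\<close> of \<open>a\<close>, where the condition defining
        \<open>A m\<close> applies.\<close>
      define d where "d = min (min d1 d2) (1 / (?n * \<epsilon>))"
      have "d > 0"
        using d1(1) d2(1) \<epsilon>(1) by (simp add: d_def)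
      moreover have "norm (f y - f x - F' (y - x)) \<le> e * norm (y - x)" if y: "norm (y - x) < d" for y
      proof (cases "y = x")
        case True
        then show ?thesis
          using F'(1) by (simp add: bounded_linear.linear linear_0)
      next
        case False
        then obtain a where a: "a \<in> A m" "dist a y \<le> \<epsilon> * norm (y - x)"
          using d2(2)[of "norm (y - x)" y] y by (auto simp: d_def dist_norm norm_minus_commute)
        have "?n * \<epsilon> > 0"
          using \<epsilon>(1) by simp
        then have "\<epsilon> * norm (y - x) < 1 / ?n"
          using y by (simp add: d_def field_simps del: of_nat_Suc)
        then have "norm (y - a) < 1 / ?n"
          using a(2) by (simp add: dist_norm norm_minus_commute)
        then have "\<bar>f (a + (y - a)) - f a\<bar> \<le> ?n * norm (y - a)"
          using a(1) unfolding A_def by blast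
        then have 1: "\<bar>f y - f a\<bar> \<le> ?n * norm (y - a)"
          by simp
        have 2: "\<bar>F m y - F m a\<bar> \<le> L m * norm (y - a)"
          using lipschitz_onD[OF F(1), of y a m] by (simp add: dist_real_def dist_norm)
        have "\<bar>f y - F m y\<bar> \<le> k * norm (y - a)"
          using 1 2 F(2)[OF a(1)] by (simp add: k_def distrib_right del: of_nat_Suc)
        also have "\<dots> \<le> k * (\<epsilon> * norm (y - x))"
          using a(2) k by (intro mult_left_mono) (auto simp: dist_norm norm_minus_commute)
        also have "\<dots> = e / 2 * norm (y - x)"
          using \<epsilon>(2) by (simp add: mult.assoc[symmetric])
        finally have 3: "\<bar>f y - F m y\<bar> \<le> e / 2 * norm (y - x)" .
        have 4: "\<bar>F m y - F m x - F' (y - x)\<bar> \<le> e / 2 * norm (y - x)"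
          using d1(2)[of y] y by (simp add: d_def)
        have "e * norm (y - x) = e / 2 * norm (y - x) + e / 2 * norm (y - x)"
          by simp
        then show ?thesis
          using 3 4 F(2)[OF x(1)] unfolding real_norm_def by linarith
      qed
      ultimately show ?thesis
        by blast
    qed
    then show ?thesis
      using F'(1) unfolding differentiable_def has_derivative_at_alt by blast
  qed
  moreover have "\<exists>m. x \<in> A m" if M: "\<delta> > 0" "\<forall>h. norm h < \<delta> \<longrightarrow> \<bar>f (x + h) - f x\<bar> \<le> M * norm h" for x M \<delta>
  proof -
    obtain m where m: "max (max M \<bar>f x\<bar>) (1 / \<delta>) \<le> real m"
      using real_arch_simple by blast
    then have "1 / \<delta> \<le> real (Suc m)" "\<bar>f x\<bar> \<le> real (Suc m)" "M \<le> real (Suc m)"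
      by auto
    then have "1 / real (Suc m) \<le> \<delta>"
      using M(1) by (simp add: field_simps del: of_nat_Suc)
    then have "\<bar>f (x + h) - f x\<bar> \<le> real (Suc m) * norm h" if "norm h < 1 / real (Suc m)" for h
      using M(2) that mult_right_mono[OF \<open>M \<le> real (Suc m)\<close>, of "norm h"]
      by (meson norm_ge_zero order_less_le_trans order_trans)
    then show ?thesis
      using \<open>\<bar>f x\<bar> \<le> real (Suc m)\<close> unfolding A_def by blast
  qed
  ultimately have "{x. (\<exists>M. \<exists>\<delta>>0. \<forall>h. norm h < \<delta> \<longrightarrow> \<bar>f (x + h) - f x\<bar> \<le> M * norm h) \<and> \<not> f differentiable (at x)} \<subseteq> B"
    by blast
  with \<open>negligible B\<close> show ?thesis
    by (rule negligible_subset)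
qed

subsection \<open>Lusin's theorem and measurability\<close>

text \<open>The preimage \<open>P n\<close> of each set of a countable basis is enclosed in an open
  set \<open>W n\<close>. Once the small differences are removed, \<open>P n\<close> and
  \<open>W n\<close> have the same trace on \<open>C\<close>, so preimages of open sets are
  relatively open.\<close>

lemma Lusin_closed:
  fixes f :: "'a::euclidean_space \<Rightarrow> real"
  assumes U: "U \<in> sets lebesgue" and f: "f \<in> borel_measurable (lebesgue_on U)" and "e > 0"
  obtains C where "closed C" "C \<subseteq> U" "continuous_on C f" "emeasure lebesgue (U - C) \<le> ennreal e"
proof -
  obtain \<B> :: "real set set" where \<B>: "countable \<B>" "topological_basis \<B>"
    using ex_countable_basis by blast
  then have "\<B> \<noteq> {}"
    unfolding topological_basis_def by (metis Union_empty all_not_in_conv empty_not_UNIV open_UNIV subset_empty)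
  define b where "b = from_nat_into \<B>"
  have b_open: "open (b n)" for n
    using \<B>(2) from_nat_into[OF \<open>\<B> \<noteq> {}\<close>, of n] by (auto simp: b_def topological_basis_open)
  have b_basis: "\<exists>n. y \<in> b n \<and> b n \<subseteq> V" if V: "open V" "y \<in> V" for y V
  proof -
    obtain B where "B \<in> \<B>" "y \<in> B" "B \<subseteq> V"
      using topological_basisE[OF \<B>(2) V] by blast
    then show ?thesis
      using from_nat_into_surj[OF \<B>(1)] unfolding b_def by metis
  qed
  define P where "P n = {x \<in> U. f x \<in> b n}" for n
  have P: "P n \<in> sets lebesgue" for n
  proof -
    have "f -` b n \<inter> space (lebesgue_on U) \<in> sets (lebesgue_on U)"
      using f b_open by (intro measurable_sets) auto
    moreover have "f -` b n \<inter> space (lebesgue_on U) = P n"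
      by (auto simp: P_def space_restrict_space)
    ultimately show ?thesis
      using U by (simp add: sets_restrict_space_iff)
  qed
  \<comment> \<open>These errors sum to \<open>e / 2\<close>; the other half is spent on the closed
    inner approximation.\<close>
  let ?e = "\<lambda>n. e / 2 * (1 / 2) ^ Suc n"
  have "\<exists>O'. open O' \<and> P n \<subseteq> O' \<and> emeasure lebesgue (O' - P n) < ennreal (?e n)" for n
    using sets_lebesgue_outer_open[OF P, of "?e n" n] \<open>e > 0\<close> by (metis divide_pos_pos mult_pos_pos zero_less_numeral zero_less_one zero_less_power)
  then obtain W where W: "\<And>n. open (W n)" "\<And>n. P n \<subseteq> W n" "\<And>n. emeasure lebesgue (W n - P n) < ennreal (?e n)"
    by metis
  define N where "N = (\<Union>n. W n - P n)"
  have WP: "W n - P n \<in> sets lebesgue" for n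
    using W(1) P by (intro sets.Diff) (auto simp: borel_open)
  have N: "N \<in> sets lebesgue"
    unfolding N_def using WP by blast
  have "(\<lambda>n. ?e n) sums (e / 2)"
    using sums_mult[OF power_half_series, of "e / 2"] by simp
  then have sum: "(\<Sum>n. ennreal (?e n)) = ennreal (e / 2)"
    using \<open>e > 0\<close> by (intro suminf_ennreal_eq) auto
  have "emeasure lebesgue N \<le> (\<Sum>n. emeasure lebesgue (W n - P n))"
    unfolding N_def using WP by (intro emeasure_subadditive_countably) auto
  also have "\<dots> \<le> (\<Sum>n. ennreal (?e n))"
    using W(3) by (intro suminf_le) (auto intro: less_imp_le)
  finally have Ne: "emeasure lebesgue N \<le> ennreal (e / 2)"
    by (simp only: sum)
  obtain C where C: "closed C" "C \<subseteq> U - N" "emeasure lebesgue ((U - N) - C) < ennreal (e / 2)"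
    by (rule sets_lebesgue_inner_closed[OF sets.Diff[OF U N] half_gt_zero[OF \<open>e > 0\<close>]])
  show ?thesis
  proof
    show "closed C" "C \<subseteq> U"
      using C by auto
    show "continuous_on C f"
      unfolding continuous_on_topological
    proof (intro ballI allI impI)
      fix x V assume "x \<in> C" "open V" "f x \<in> V"
      obtain n where n: "f x \<in> b n" "b n \<subseteq> V"
        using b_basis[OF \<open>open V\<close> \<open>f x \<in> V\<close>] by blast
      have "x \<in> W n"
        using \<open>x \<in> C\<close> C(2) n(1) W(2)[of n] by (auto simp: P_def)
      moreover have "f y \<in> V" if "y \<in> C" "y \<in> W n" for y
      proof -
        have "y \<in> P n"
          using that C(2) by (auto simp: N_def)
        then show ?thesis
          using n(2) by (auto simp: P_def)
      qed
      ultimately show "\<exists>A. open A \<and> x \<in> A \<and> (\<forall>y\<in>C. y \<in> A \<longrightarrow> f y \<in> V)"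
        using W(1) by blast
    qed
    have "emeasure lebesgue (U - C) \<le> emeasure lebesgue (N \<union> ((U - N) - C))"
      using U N C(1) by (intro emeasure_mono) (auto intro!: sets.Diff sets.Un simp: borel_closed)
    also have "\<dots> \<le> emeasure lebesgue N + emeasure lebesgue ((U - N) - C)"
      using U N C(1) by (intro emeasure_subadditive) (auto intro!: sets.Diff simp: borel_closed)
    also have "\<dots> \<le> ennreal (e / 2) + ennreal (e / 2)"
      using Ne C(3) by (intro add_mono) auto
    also have "\<dots> = ennreal e"
      using \<open>e > 0\<close> by (simp flip: ennreal_plus)
    finally show "emeasure lebesgue (U - C) \<le> ennreal e" .
  qed
qed

lemma Lusin_sigma_compact:
  fixes f :: "'a::euclidean_space \<Rightarrow> real"
  assumes U: "U \<in> sets lebesgue" and f: "f \<in> borel_measurable (lebesgue_on U)"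
  obtains K :: "nat \<Rightarrow> nat \<Rightarrow> 'a set" where "\<And>i j. compact (K i j)" "\<And>i j. continuous_on (K i j) f"
    "negligible (U - (\<Union>i. \<Union>j. K i j))"
proof -
  have "\<forall>i. \<exists>C. closed C \<and> continuous_on C f \<and> emeasure lebesgue (U - C) \<le> ennreal (1 / real (Suc i))"
    using Lusin_closed[OF U f] by (metis zero_less_divide_1_iff of_nat_0_less_iff zero_less_Suc)
  then obtain C where C: "\<And>i. closed (C i)" "\<And>i. continuous_on (C i) f"
      "\<And>i. emeasure lebesgue (U - C i) \<le> ennreal (1 / real (Suc i))"
    by metis
  define N where "N = U - (\<Union>i. C i)"
  have CS: "U - C i \<in> sets lebesgue" for i
    using U C(1) by (intro sets.Diff) (auto simp: borel_closed)
  have NS: "N \<in> sets lebesgue"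
    unfolding N_def using U C(1) by (intro sets.Diff sets.countable_UN) (auto simp: borel_closed)
  have Nle: "emeasure lebesgue N \<le> ennreal (1 / real (Suc i))" for i
  proof -
    have "emeasure lebesgue N \<le> emeasure lebesgue (U - C i)"
      using CS[of i] by (intro emeasure_mono) (auto simp: N_def)
    then show ?thesis
      using C(3)[of i] by (rule order_trans)
  qed
  have N_eps: "emeasure lebesgue N \<le> 0 + ennreal e" if "e > 0" for e
  proof -
    obtain i where i: "1 / real (Suc i) < e"
      using nat_approx_posE[OF \<open>e > 0\<close>] by blast
    show ?thesis
      using order_trans[OF Nle ennreal_leI[OF less_imp_le[OF i]]] by (simp only: add_0)
  qed
  have "emeasure lebesgue N \<le> 0"
    by (rule ennreal_le_epsilon) (rule N_eps)
  then have "negligible N"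
    using NS by (simp add: negligible_iff_null_sets null_sets_def)
  moreover have "(\<Union>i. \<Union>j. C i \<inter> cball 0 (real j)) = (\<Union>i. C i)"
    using real_arch_simple by fastforce
  ultimately have "negligible (U - (\<Union>i. \<Union>j. C i \<inter> cball 0 (real j)))"
    by (simp add: N_def)
  moreover have "compact (C i \<inter> cball 0 (real j))" "continuous_on (C i \<inter> cball 0 (real j)) f" for i j
    using C by (auto simp: closed_Int_compact intro: continuous_on_subset)
  ultimately show ?thesis
    using that[of "\<lambda>i j. C i \<inter> cball 0 (real j)"] by blast
qed

text \<open>Failure of the strict kind is failure by at least \<open>1 / real (Suc n)\<close> for
  some \<open>n\<close>. Pairs \<open>(z, t)\<close> failing by that margin form a compact set,
  whose projection is compact, so the failing points in \<open>K\<close> are a countable union of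
  compact sets.\<close>

lemma sets_borel_coordinate_lipschitz_points:
  fixes f :: "'a::euclidean_space \<Rightarrow> real"
  assumes K: "compact K" "continuous_on K f"
  shows "{z \<in> K. \<forall>b\<in>Basis. \<forall>t. \<bar>t\<bar> \<le> \<rho> \<longrightarrow> z + t *\<^sub>R b \<in> K \<longrightarrow> \<bar>f (z + t *\<^sub>R b) - f z\<bar> \<le> M * \<bar>t\<bar>} \<in> sets borel"
    (is "?P \<in> _")
proof -
  define S where "S b = (K \<times> cball (0::real) \<rho>) \<inter> (\<lambda>p. fst p + snd p *\<^sub>R b) -` K" for b :: 'a
  define g where "g b p = \<bar>f (fst p + snd p *\<^sub>R b) - f (fst p)\<bar> - M * \<bar>snd p\<bar>" for b and p :: "'a \<times> real"
  define Q where "Q b n = S b \<inter> g b -` {1 / real (Suc n)..}" for b n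
  have "closed ((\<lambda>p. fst p + snd p *\<^sub>R b) -` K)" for b :: 'a
    using compact_imp_closed[OF K(1)] by (intro closed_vimage continuous_intros)
  then have S: "compact (S b)" for b
    unfolding S_def using K(1) by (intro compact_Int_closed compact_Times) auto
  have "continuous_on (S b) (g b)" for b
    unfolding g_def
    by (intro continuous_intros continuous_on_compose2[OF K(2)]) (auto simp: S_def)
  then have Q: "compact (Q b n)" for b n
    unfolding Q_def
    using S compact_Int_closed continuous_closed_preimage[OF _ compact_imp_closed[OF S] closed_atLeast]
    by (metis Int_absorb inf.assoc)
  have "?P = K - (\<Union>b\<in>Basis. \<Union>n. fst ` Q b n)"
  proof (intro set_eqI iffI)
    fix z assume z: "z \<in> ?P"
    have "z \<notin> fst ` Q b n" if b: "b \<in> Basis" for b n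
    proof
      assume "z \<in> fst ` Q b n"
      then obtain t where t: "\<bar>t\<bar> \<le> \<rho>" "z + t *\<^sub>R b \<in> K" "1 / real (Suc n) \<le> \<bar>f (z + t *\<^sub>R b) - f z\<bar> - M * \<bar>t\<bar>"
        unfolding Q_def S_def g_def by auto
      have "\<bar>f (z + t *\<^sub>R b) - f z\<bar> \<le> M * \<bar>t\<bar>"
        using z b t(1,2) by blast
      moreover have "1 / real (Suc n) > 0"
        by simp
      ultimately show False
        using t(3) by linarith
    qed
    then show "z \<in> K - (\<Union>b\<in>Basis. \<Union>n. fst ` Q b n)"
      using z by blast
  next
    fix z assume z: "z \<in> K - (\<Union>b\<in>Basis. \<Union>n. fst ` Q b n)"
    have "\<bar>f (z + t *\<^sub>R b) - f z\<bar> \<le> M * \<bar>t\<bar>" if t: "b \<in> Basis" "\<bar>t\<bar> \<le> \<rho>" "z + t *\<^sub>R b \<in> K" for b t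
    proof (rule ccontr)
      assume "\<not> ?thesis"
      then obtain n where "1 / real (Suc n) < \<bar>f (z + t *\<^sub>R b) - f z\<bar> - M * \<bar>t\<bar>"
        using nat_approx_posE[of "\<bar>f (z + t *\<^sub>R b) - f z\<bar> - M * \<bar>t\<bar>"] by (metis diff_gt_0_iff_gt not_le)
      then have "(z, t) \<in> Q b n"
        using z t by (simp add: Q_def S_def g_def)
      then have "z \<in> fst ` Q b n"
        by force
      then show False
        using z t(1) by blast
    qed
    then show "z \<in> ?P"
      using z by blast
  qed
  moreover have "K - (\<Union>b\<in>Basis. \<Union>n. fst ` Q b n) \<in> sets borel"
  proof (rule sets.Diff)
    have "fst ` Q b n \<in> sets borel" for b n
      using Q by (intro borel_compact compact_continuous_image continuous_intros)
    then show "(\<Union>b\<in>Basis. \<Union>n. fst ` Q b n) \<in> sets borel"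
      by (intro sets.finite_UN sets.countable_UN) auto
  qed (simp add: borel_compact[OF K(1)])
  ultimately show ?thesis
    by simp
qed

subsection \<open>Bounded second differences imply a pointwise Lipschitz bound\<close>

text \<open>Such a map multiplies measure by the product of the \<open>\<bar>c j\<bar>\<close>,
  which is at least 1, so taking preimages cannot increase measure.\<close>

lemma lmeasurable_diagonal_affine_preimage:
  fixes B :: "'a::euclidean_space set"
  assumes B: "B \<in> lmeasurable" and c: "\<And>j. j \<in> Basis \<Longrightarrow> 1 \<le> \<bar>c j\<bar>"
  shows "{z. t + (\<Sum>j\<in>Basis. (c j * (z \<bullet> j)) *\<^sub>R j) \<in> B} \<in> lmeasurable" (is ?m)
    and "measure lebesgue {z. t + (\<Sum>j\<in>Basis. (c j * (z \<bullet> j)) *\<^sub>R j) \<in> B} \<le> measure lebesgue B" (is ?le)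
proof -
  define T where "T z = t + (\<Sum>j\<in>Basis. (c j * (z \<bullet> j)) *\<^sub>R j)" for z
  have c0: "c j \<noteq> 0" if "j \<in> Basis" for j
    using c[OF that] by auto
  have Bs: "B \<in> sets lebesgue"
    using B by (rule fmeasurableD)
  have T: "T \<in> lebesgue \<rightarrow>\<^sub>M lebesgue"
    unfolding T_def using c0 by (rule lebesgue_affine_measurable)
  then have meas: "T -` B \<in> sets lebesgue"
    using measurable_sets[OF T Bs] by simp
  have "emeasure lebesgue B = emeasure (density (distr lebesgue lebesgue T) (\<lambda>_. (\<Prod>j\<in>Basis. \<bar>c j\<bar>))) B"
    unfolding T_def using lebesgue_affine_euclidean[of c t, OF c0] by simp
  also have "\<dots> = ennreal (\<Prod>j\<in>Basis. \<bar>c j\<bar>) * emeasure lebesgue (T -` B)"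
    using T Bs by (subst emeasure_density) (auto simp: nn_integral_cmult_indicator emeasure_distr)
  also have "1 * emeasure lebesgue (T -` B) \<le> ennreal (\<Prod>j\<in>Basis. \<bar>c j\<bar>) * emeasure lebesgue (T -` B)"
    using c by (intro mult_right_mono) (auto intro!: prod_ge_1)
  finally have le: "emeasure lebesgue (T -` B) \<le> emeasure lebesgue B"
    by simp
  have eq: "{z. t + (\<Sum>j\<in>Basis. (c j * (z \<bullet> j)) *\<^sub>R j) \<in> B} = T -` B"
    by (auto simp: T_def)
  show m: ?m
    unfolding eq using meas le B by (intro fmeasurableI) (auto simp: fmeasurable_def)
  show ?le
    using le m[unfolded eq] B unfolding eq by (simp add: emeasure_eq_measure2)
qed

definition flip :: "'a::euclidean_space set \<Rightarrow> 'a \<Rightarrow> 'a" where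
  "flip I v = (\<Sum>b\<in>Basis. ((if b \<in> I then - 1 else 1) * (v \<bullet> b)) *\<^sub>R b)"

lemma flip_inner: "b \<in> Basis \<Longrightarrow> flip I v \<bullet> b = (if b \<in> I then - 1 else 1) * (v \<bullet> b)"
  by (simp add: flip_def)

lemma norm_flip [simp]: "norm (flip I v) = norm v"
proof -
  have "flip I v \<bullet> flip I v = (\<Sum>b\<in>Basis. (flip I v \<bullet> b) * (flip I v \<bullet> b))"
    by (rule euclidean_inner)
  also have "\<dots> = (\<Sum>b\<in>Basis. (v \<bullet> b) * (v \<bullet> b))"
    by (intro sum.cong refl) (simp add: flip_inner)
  also have "\<dots> = v \<bullet> v"
    by (rule euclidean_inner[symmetric])
  finally show ?thesis
    by (simp add: norm_eq)
qed

lemma flip_empty [simp]: "flip {} v = v"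
  by (rule euclidean_eqI) (simp add: flip_inner)

lemma flip_Basis [simp]: "flip Basis v = - v"
  by (rule euclidean_eqI) (simp add: flip_inner)

lemma flip_insert:
  assumes "b \<in> Basis" "b \<notin> I"
  shows "flip (insert b I) v = flip I v + (- 2 * (v \<bullet> b)) *\<^sub>R b"
proof (rule euclidean_eqI)
  fix a :: 'a assume "a \<in> Basis"
  then show "flip (insert b I) v \<bullet> a = (flip I v + (- 2 * (v \<bullet> b)) *\<^sub>R b) \<bullet> a"
    using assms by (auto simp: flip_inner inner_add_left inner_diff_left inner_Basis)
qed

text \<open>The path from \<open>x + v\<close> to \<open>x - v\<close> flips one coordinate at a
  time and has its vertices in \<open>P\<close>. A flip moves by twice a coordinate of
  \<open>v\<close>, hence by at most \<open>2 * norm v\<close>.\<close>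

lemma flip_chain_bound:
  fixes f :: "'a::euclidean_space \<Rightarrow> real"
  assumes step: "\<And>z b t. \<lbrakk>z \<in> P; z + t *\<^sub>R b \<in> P; b \<in> Basis; \<bar>t\<bar> \<le> \<rho>\<rbrakk> \<Longrightarrow> \<bar>f (z + t *\<^sub>R b) - f z\<bar> \<le> M * \<bar>t\<bar>"
    and P: "\<And>I. I \<subseteq> Basis \<Longrightarrow> x + flip I v \<in> P"
    and v: "2 * norm v \<le> \<rho>" and "0 \<le> M"
  shows "\<bar>f (x - v) - f (x + v)\<bar> \<le> DIM('a) * (2 * M * norm v)"
proof -
  have "\<bar>f (x + flip I v) - f (x + v)\<bar> \<le> card I * (2 * M * norm v)" if "finite I" "I \<subseteq> Basis" for I
    using that
  proof (induction I rule: finite_induct)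
    case (insert b I)
    have b: "b \<in> Basis" "\<bar>v \<bullet> b\<bar> \<le> norm v"
      using insert.prems by (auto intro: Basis_le_norm)
    define t where "t = - 2 * (v \<bullet> b)"
    have t: "\<bar>t\<bar> \<le> 2 * norm v"
      using b(2) by (simp add: t_def abs_mult)
    have eq: "x + flip (insert b I) v = (x + flip I v) + t *\<^sub>R b"
      using flip_insert[OF b(1) insert.hyps(2), of v] by (simp add: t_def)
    have "\<bar>f ((x + flip I v) + t *\<^sub>R b) - f (x + flip I v)\<bar> \<le> M * \<bar>t\<bar>"
      using P[of I] P[OF insert.prems] insert.prems b(1) t v by (intro step) (auto simp: eq)
    also have "\<dots> \<le> 2 * M * norm v"
      using mult_left_mono[OF t \<open>0 \<le> M\<close>] by simp
    finally have "\<bar>f (x + flip (insert b I) v) - f (x + flip I v)\<bar> \<le> 2 * M * norm v"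
      by (simp only: eq)
    moreover have "\<bar>f (x + flip I v) - f (x + v)\<bar> \<le> card I * (2 * M * norm v)"
      using insert by simp
    moreover have card: "real (card (insert b I)) * (2 * M * norm v) = 2 * M * norm v + card I * (2 * M * norm v)"
      using insert.hyps by (simp add: algebra_simps)
    ultimately show ?case
      unfolding card by linarith
  qed simp
  from this[of Basis] show ?thesis
    by simp
qed

lemma small_flip_preimages:
  fixes B :: "'a::euclidean_space set"
  assumes B: "B \<in> lmeasurable" and k: "1 \<le> k"
  shows "{z. x + flip I (k *\<^sub>R z - w) \<in> B} \<in> lmeasurable"
    and "measure lebesgue {z. x + flip I (k *\<^sub>R z - w) \<in> B} \<le> measure lebesgue B"
proof -
  let ?s = "\<lambda>b::'a. if b \<in> I then - 1 else 1 :: real"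
  have eq: "x + flip I (k *\<^sub>R z - w) = (x - flip I w) + (\<Sum>j\<in>Basis. ((?s j * k) * (z \<bullet> j)) *\<^sub>R j)" for z
    by (rule euclidean_eqI) (simp add: flip_inner inner_diff_left inner_add_left algebra_simps)
  show "{z. x + flip I (k *\<^sub>R z - w) \<in> B} \<in> lmeasurable"
    "measure lebesgue {z. x + flip I (k *\<^sub>R z - w) \<in> B} \<le> measure lebesgue B"
    unfolding eq using k by (intro lmeasurable_diagonal_affine_preimage[OF B]; simp add: abs_mult)+
qed

text \<open>
  In \<open>cball x r\<close>, each of the \<open>2 ^ (d + 1)\<close> conditions fails on a set of measure at most that of
  \<open>cball x (3 * r) - P\<close>, and \<open>2 ^ (d + 1) * 3 ^ d / (4 * 6 ^ d) = 1 / 2\<close>.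
\<close>

lemma obtain_point_with_good_flips:
  fixes A P :: "'a::euclidean_space set"
  assumes P: "P \<in> sets lebesgue" "A \<subseteq> P" and "0 < r"
    and dens1: "\<not> misses_part A (1 / 2) x r"
    and dens3: "\<not> misses_part A (1 / (4 * 6 ^ DIM('a))) x (3 * r)"
    and h: "norm h \<le> r"
  obtains z where "z \<in> A" "norm (z - x) \<le> r"
    "\<And>I. I \<subseteq> Basis \<Longrightarrow> x + flip I (z - x) \<in> P"
    "\<And>I. I \<subseteq> Basis \<Longrightarrow> x + flip I (2 *\<^sub>R (z - x) - h) \<in> P"
proof -
  let ?D = "DIM('a)"
  \<comment> \<open>Radius \<open>3 * r\<close> accommodates both kinds of vector:
    \<open>z - x\<close> has norm at most \<open>r\<close>, and twice it minus \<open>h\<close> at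
    most \<open>3 * r\<close>.\<close>
  define B where "B = cball x (3 * r) - P"
  have B: "B \<in> lmeasurable"
    unfolding B_def using P(1) by (intro fmeasurable_Diff) auto
  have "measure lebesgue B < 1 / (4 * 6 ^ ?D) * measure lebesgue (cball x (3 * r))"
  proof (rule ccontr)
    assume "\<not> ?thesis"
    then have "misses_part A (1 / (4 * 6 ^ ?D)) x (3 * r)"
      unfolding misses_part_def using B P(2) by (intro bexI[of _ B]) (auto simp: B_def)
    with dens3 show False ..
  qed
  also have "measure lebesgue (cball x (3 * r)) = 3 ^ ?D * measure lebesgue (cball x r)"
    using \<open>0 < r\<close> by (simp only: measure_lebesgue_cball less_imp_le power_mult_distrib mult_nonneg_nonneg) simp
  also have "1 / (4 * 6 ^ ?D) * (3 ^ ?D * measure lebesgue (cball x r)) = measure lebesgue (cball x r) / (4 * 2 ^ ?D)"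
    using power_mult_distrib[of 2 "3::real" ?D] by (simp add: field_simps)
  finally have Bsmall: "2 * 2 ^ ?D * measure lebesgue B \<le> measure lebesgue (cball x r) / 2"
    by (simp add: field_simps)
  define E where "E I = {z. x + flip I (1 *\<^sub>R z - x) \<in> B} \<union> {z. x + flip I (2 *\<^sub>R z - (2 *\<^sub>R x + h)) \<in> B}" for I
  have E: "E I \<in> lmeasurable" "measure lebesgue (E I) \<le> 2 * measure lebesgue B" for I
  proof -
    note small1 = small_flip_preimages[OF B, of 1 x I x]
    note small2 = small_flip_preimages[OF B, of 2 x I "2 *\<^sub>R x + h"]
    show "E I \<in> lmeasurable"
      unfolding E_def using small1(1) small2(1) by (intro fmeasurable.Un) auto
    have "measure lebesgue (E I) \<le> measure lebesgue {z. x + flip I (1 *\<^sub>R z - x) \<in> B} + measure lebesgue {z. x + flip I (2 *\<^sub>R z - (2 *\<^sub>R x + h)) \<in> B}"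
      unfolding E_def using small1(1) small2(1) by (intro measure_Un_le fmeasurableD) auto
    then show "measure lebesgue (E I) \<le> 2 * measure lebesgue B"
      using small1(2) small2(2) by simp
  qed
  define Bad where "Bad = (\<Union>I\<in>Pow Basis. E I)"
  have Bad: "Bad \<in> lmeasurable"
    unfolding Bad_def using E(1) by (intro fmeasurable.finite_UN) auto
  have "measure lebesgue Bad \<le> (\<Sum>I\<in>Pow Basis. measure lebesgue (E I))"
    unfolding Bad_def using E(1) by (intro measure_UNION_le) (auto simp: fmeasurableD)
  also have "\<dots> \<le> (\<Sum>I\<in>Pow (Basis :: 'a set). 2 * measure lebesgue B)"
    using E(2) by (intro sum_mono)
  also have "\<dots> = 2 * 2 ^ ?D * measure lebesgue B"
    by (simp add: card_Pow)
  finally have Bad_le: "measure lebesgue Bad \<le> measure lebesgue (cball x r) / 2"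
    using Bsmall by linarith
  \<comment> \<open>The bad points fill at most half of the ball. If the rest avoided
    \<open>A\<close>, it would be a missed set of proportion one half.\<close>
  have "(cball x r - Bad) \<inter> A \<noteq> {}"
  proof
    assume "(cball x r - Bad) \<inter> A = {}"
    moreover have rest: "cball x r - Bad \<in> lmeasurable"
      using Bad by (intro fmeasurable_Diff fmeasurableD) auto
    moreover have "measure lebesgue (cball x r) \<le> measure lebesgue Bad + measure lebesgue (cball x r - Bad)"
    proof -
      have "measure lebesgue (cball x r) \<le> measure lebesgue (Bad \<union> (cball x r - Bad))"
        using Bad rest by (intro measure_mono_fmeasurable fmeasurable.Un) auto
      also have "\<dots> \<le> measure lebesgue Bad + measure lebesgue (cball x r - Bad)"
        using Bad rest by (intro measure_Un_le fmeasurableD)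
      finally show ?thesis .
    qed
    then have "1 / 2 * measure lebesgue (cball x r) \<le> measure lebesgue (cball x r - Bad)"
      using Bad_le by linarith
    ultimately have "misses_part A (1 / 2) x r"
      unfolding misses_part_def by (intro bexI[of _ "cball x r - Bad"]) auto
    with dens1 show False ..
  qed
  then obtain z where z: "z \<in> A" "norm (z - x) \<le> r" "z \<notin> Bad"
    by (auto simp: dist_norm norm_minus_commute)
  have notE: "z \<notin> E I" if "I \<subseteq> Basis" for I
    using z(3) that by (auto simp: Bad_def)
  have good: "x + flip I v \<in> P" if "x + flip I v \<notin> B" "norm v \<le> 3 * r" for I v
    using that by (auto simp: B_def dist_norm)
  have w: "2 *\<^sub>R (z - x) - h = 2 *\<^sub>R z - (2 *\<^sub>R x + h)"
    by (simp add: scaleR_diff_right)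
  have "norm (2 *\<^sub>R (z - x) - h) \<le> 3 * r"
    using norm_triangle_ineq4[of "2 *\<^sub>R (z - x)" h] z(2) h by simp
  then show thesis
    using z(1,2) notE good \<open>0 < r\<close> by (intro that[of z]) (auto simp: E_def w)
qed

section \<open>The Lipschitz bound at outer density points\<close>

lemma pointwise_lipschitz_if_outer_density_point:
  fixes f :: "'a::euclidean_space \<Rightarrow> real"
  assumes K: "compact K" "continuous_on K f" and "A \<subseteq> K" "0 \<le> M" "0 < \<rho>"
    and coord: "\<And>z b t. \<lbrakk>z \<in> A; b \<in> Basis; \<bar>t\<bar> \<le> \<rho>\<rbrakk> \<Longrightarrow> \<bar>f (z + t *\<^sub>R b) - f z\<bar> \<le> M * \<bar>t\<bar>"
    and second: "\<And>z k. \<lbrakk>z \<in> A; norm k \<le> \<rho>\<rbrakk> \<Longrightarrow> \<bar>f (z + k) + f (z - k) - 2 * f z\<bar> \<le> M * norm k"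
    and x: "x \<in> A" "outer_density_point A x"
  shows "\<exists>C. \<exists>\<delta>>0. \<forall>h. norm h < \<delta> \<longrightarrow> \<bar>f (x + h) - f x\<bar> \<le> C * norm h"
proof -
  let ?D = "real DIM('a)"
  define P where "P = {z \<in> K. \<forall>b\<in>Basis. \<forall>t. \<bar>t\<bar> \<le> \<rho> \<longrightarrow> z + t *\<^sub>R b \<in> K \<longrightarrow> \<bar>f (z + t *\<^sub>R b) - f z\<bar> \<le> M * \<bar>t\<bar>}"
  have P: "P \<in> sets lebesgue"
    using sets_borel_coordinate_lipschitz_points[OF K, of \<rho> M] unfolding P_def by simp
  have AP: "A \<subseteq> P"
    using coord \<open>A \<subseteq> K\<close> by (auto simp: P_def)
  have step: "\<bar>f (z + t *\<^sub>R b) - f z\<bar> \<le> M * \<bar>t\<bar>"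
    if "z \<in> P" "z + t *\<^sub>R b \<in> P" "b \<in> Basis" "\<bar>t\<bar> \<le> \<rho>" for z b t
    using that by (auto simp: P_def)
  obtain d1 where d1: "d1 > 0" "\<And>r. \<lbrakk>0 < r; r < d1\<rbrakk> \<Longrightarrow> \<not> misses_part A (1 / 2) x r"
    using x(2) unfolding outer_density_point_def by (metis half_gt_zero zero_less_one)
  have "1 / (4 * 6 ^ DIM('a)) > (0::real)"
    by simp
  then obtain d2 where d2: "d2 > 0" "\<And>r. \<lbrakk>0 < r; r < d2\<rbrakk> \<Longrightarrow> \<not> misses_part A (1 / (4 * 6 ^ DIM('a))) x r"
    using x(2) unfolding outer_density_point_def by metis
  \<comment> \<open>The difference \<open>f (x + v) - f (x - v)\<close> plus the second difference
    at \<open>x\<close> is twice \<open>f (x + v) - f x\<close>.\<close>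
  have reflect: "\<bar>f (x + v) - f x\<bar> \<le> (2 * ?D + 1) * (M * norm v)"
    if "\<And>I. I \<subseteq> Basis \<Longrightarrow> x + flip I v \<in> P" "2 * norm v \<le> \<rho>" for v
  proof -
    have "\<bar>f (x - v) - f (x + v)\<bar> \<le> ?D * (2 * M * norm v)"
      by (rule flip_chain_bound[OF step that \<open>0 \<le> M\<close>])
    moreover have "?D * (2 * M * norm v) = 2 * (?D * (M * norm v))"
      by simp
    moreover have "\<bar>f (x + v) + f (x - v) - 2 * f x\<bar> \<le> M * norm v"
      using that(2) norm_ge_zero[of v] by (intro second[OF x(1)]) linarith
    moreover have "(2 * ?D + 1) * (M * norm v) = 2 * (?D * (M * norm v)) + M * norm v"
      by (simp add: algebra_simps)
    moreover have "0 \<le> ?D * (M * norm v)" "0 \<le> M * norm v"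
      using \<open>0 \<le> M\<close> by simp_all
    ultimately show ?thesis
      by linarith
  qed
  \<comment> \<open>Density is used at radii \<open>r\<close> and \<open>3 * r\<close>, whence
    \<open>d2 / 3\<close>; reflecting a vector of norm up to \<open>3 * r\<close> requires
    \<open>6 * r \<le> \<rho>\<close>.\<close>
  define \<delta> where "\<delta> = min (min d1 (d2 / 3)) (\<rho> / 6)"
  \<comment> \<open>The increment \<open>f (x + h) - f x\<close> is the second difference at
    \<open>z\<close>, minus \<open>f (x + w) - f x\<close>, plus twice \<open>f z - f x\<close>.
    With q = 2d + 1 these contribute 2Mr, 3qMr and 2qMr.\<close>
  define C where "C = (2 + 5 * (2 * ?D + 1)) * M"
  have "\<delta> > 0"
    using d1(1) d2(1) \<open>0 < \<rho>\<close> by (simp add: \<delta>_def)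
  moreover have "\<bar>f (x + h) - f x\<bar> \<le> C * norm h" if h: "norm h < \<delta>" for h
  proof (cases "h = 0")
    case False
    define r where "r = norm h"
    have r: "0 < r" "r < d1" "3 * r < d2" "6 * r \<le> \<rho>"
      using False h by (auto simp: r_def \<delta>_def)
    obtain z where z: "z \<in> A" "norm (z - x) \<le> r"
      "\<And>I. I \<subseteq> Basis \<Longrightarrow> x + flip I (z - x) \<in> P"
      "\<And>I. I \<subseteq> Basis \<Longrightarrow> x + flip I (2 *\<^sub>R (z - x) - h) \<in> P"
      using obtain_point_with_good_flips[OF P AP r(1) d1(2)[OF r(1,2)] d2(2)[OF _ r(3)], of h] r(1)
      by (metis order_refl r_def zero_less_mult_iff zero_less_numeral)
    define w where "w = 2 *\<^sub>R (z - x) - h"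
    have w: "norm w \<le> 3 * r"
      using norm_triangle_ineq4[of "2 *\<^sub>R (z - x)" h] z(2) by (simp add: w_def r_def)
    have pos: "0 \<le> (2 * ?D + 1)"
      by simp
    have "\<bar>f (x + (z - x)) - f x\<bar> \<le> (2 * ?D + 1) * (M * norm (z - x))"
      using z(2,3) r(1,4) by (intro reflect) auto
    also have "\<dots> \<le> (2 * ?D + 1) * (M * r)"
      using z(2) \<open>0 \<le> M\<close> by (intro mult_left_mono) auto
    finally have 1: "\<bar>f z - f x\<bar> \<le> (2 * ?D + 1) * (M * r)"
      by simp
    have "\<bar>f (x + w) - f x\<bar> \<le> (2 * ?D + 1) * (M * norm w)"
      using z(4) w r(1,4) by (intro reflect) (auto simp: w_def)
    also have "\<dots> \<le> (2 * ?D + 1) * (M * (3 * r))"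
      using w \<open>0 \<le> M\<close> by (intro mult_left_mono) auto
    finally have 2: "\<bar>f (x + w) - f x\<bar> \<le> 3 * ((2 * ?D + 1) * (M * r))"
      by (simp add: mult.assoc mult.left_commute)
    \<comment> \<open>The points \<open>x + h\<close> and \<open>x + w\<close> are mirror images in
      \<open>z\<close>.\<close>
    define k where "k = x + h - z"
    have k: "norm k \<le> 2 * r" "z + k = x + h" "z - k = x + w"
      using norm_triangle_ineq4[of h "z - x"] z(2) by (simp_all add: k_def w_def r_def algebra_simps scaleR_2)
    have "\<bar>f (z + k) + f (z - k) - 2 * f z\<bar> \<le> M * norm k"
      using k(1) r(1,4) by (intro second[OF z(1)]) linarith
    also have "\<dots> \<le> M * (2 * r)"
      using k(1) \<open>0 \<le> M\<close> by (rule mult_left_mono)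
    finally have 3: "\<bar>f (x + h) + f (x + w) - 2 * f z\<bar> \<le> 2 * (M * r)"
      by (simp add: k)
    have C: "C * norm h = 2 * (M * r) + 5 * ((2 * ?D + 1) * (M * r))"
      by (simp add: C_def r_def algebra_simps)
    show ?thesis
      unfolding C using 1 2 3 by linarith
  qed simp
  ultimately show ?thesis
    by blast
qed

section \<open>From the limsup conditions to the theorem\<close>

text \<open>One natural number serves as constant and as inverse scale. Validity for every
  \<open>n\<close> from \<open>m\<close> on lets several such bounds share the same
  \<open>n\<close>.\<close>

lemma Limsup_abs_finite_imp_bound:
  fixes g :: "'a::real_normed_vector \<Rightarrow> real"
  assumes "Limsup (at 0) (\<lambda>h. ereal \<bar>g h\<bar>) < \<infinity>"
  obtains m :: nat where "\<And>n h. \<lbrakk>m \<le> n; h \<noteq> 0; norm h \<le> 1 / real (Suc n)\<rbrakk> \<Longrightarrow> \<bar>g h\<bar> \<le> real (Suc n)"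
proof -
  obtain c where "Limsup (at 0) (\<lambda>h. ereal \<bar>g h\<bar>) < ereal c"
    using ereal_dense2[OF assms] by blast
  then have "\<forall>\<^sub>F h in at 0. \<bar>g h\<bar> < c"
    by (auto dest: Limsup_lessD)
  then obtain d where d: "d > 0" "\<And>h. h \<noteq> 0 \<Longrightarrow> norm h < d \<Longrightarrow> \<bar>g h\<bar> < c"
    unfolding eventually_at by auto
  obtain m where m: "max c (1 / d) \<le> real m"
    using real_arch_simple by blast
  show thesis
  proof (rule that[of m])
    fix n and h :: 'a assume n: "m \<le> n" and h: "h \<noteq> 0" "norm h \<le> 1 / real (Suc n)"
    have "real (Suc n) > 1 / d" "real (Suc n) \<ge> c"
      using m n by auto
    then have "1 / real (Suc n) < d"
      using d(1) by (simp add: field_simps del: of_nat_Suc)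
    then show "\<bar>g h\<bar> \<le> real (Suc n)"
      using d(2)[OF h(1)] h(2) \<open>real (Suc n) \<ge> c\<close> by linarith
  qed
qed

theorem lemma1:
  fixes f :: "real ^ 'n \<Rightarrow> real" and U :: "(real ^ 'n) set"
  assumes "open U"
    and "f \<in> borel_measurable (lebesgue_on U)"
  shows "AE x in lebesgue.
    x \<in> U \<and>
    (\<forall>i. Limsup (at (0::real)) (\<lambda>t. ereal \<bar>(f (x + t *\<^sub>R axis i 1) - f x) / t\<bar>) < \<infinity>) \<and>
    Limsup (at (0 :: real ^ 'n)) (\<lambda>h. ereal \<bar>Delta2 f x h\<bar>) < \<infinity>
    \<longrightarrow> f differentiable (at x)"
proof -
  \<comment> \<open>The factor 2 in the second condition comes from the denominator
    \<open>2 * norm h\<close> of \<open>Delta2\<close>.\<close>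
  define T where "T n = {x. (\<forall>b\<in>Basis. \<forall>t. \<bar>t\<bar> \<le> 1 / real (Suc n) \<longrightarrow> \<bar>f (x + t *\<^sub>R b) - f x\<bar> \<le> real (Suc n) * \<bar>t\<bar>) \<and>
    (\<forall>h. norm h \<le> 1 / real (Suc n) \<longrightarrow> \<bar>f (x + h) + f (x - h) - 2 * f x\<bar> \<le> 2 * real (Suc n) * norm h)}" for n
  obtain K :: "nat \<Rightarrow> nat \<Rightarrow> (real ^ 'n) set" where K: "\<And>i j. compact (K i j)" "\<And>i j. continuous_on (K i j) f"
    and negK: "negligible (U - (\<Union>i. \<Union>j. K i j))"
    using Lusin_sigma_compact[of U f] assms by (metis lborelD sets_completionI_sets borel_open)
  define A where "A n i j = T n \<inter> K i j" for n i j
  define N1 where "N1 = (\<Union>n. \<Union>i. \<Union>j. {x \<in> A n i j. \<not> outer_density_point (A n i j) x})"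
  define N2 where "N2 = {x. (\<exists>M. \<exists>\<delta>>0. \<forall>h. norm h < \<delta> \<longrightarrow> \<bar>f (x + h) - f x\<bar> \<le> M * norm h) \<and> \<not> f differentiable (at x)}"
  have "negligible N1"
    unfolding N1_def by (intro negligible_Union_nat negligible_not_outer_density_point)
  moreover have "negligible N2"
    unfolding N2_def by (rule negligible_pointwise_lipschitz_not_differentiable)
  ultimately have neg: "negligible ((U - (\<Union>i. \<Union>j. K i j)) \<union> (N1 \<union> N2))"
    using negK by (intro negligible_Un)
  have T: "\<exists>n. x \<in> T n"
    if lim1: "\<And>i. Limsup (at (0::real)) (\<lambda>t. ereal \<bar>(f (x + t *\<^sub>R axis i 1) - f x) / t\<bar>) < \<infinity>"
      and lim2: "Limsup (at (0 :: real ^ 'n)) (\<lambda>h. ereal \<bar>Delta2 f x h\<bar>) < \<infinity>" for x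
  proof -
    have "\<exists>m::nat. \<forall>n t. m \<le> n \<longrightarrow> t \<noteq> 0 \<longrightarrow> norm t \<le> 1 / real (Suc n) \<longrightarrow>
        \<bar>(f (x + t *\<^sub>R axis i 1) - f x) / t\<bar> \<le> real (Suc n)" for i
      using Limsup_abs_finite_imp_bound[OF lim1[of i]] by metis
    then obtain m where m: "\<And>i n t. \<lbrakk>m i \<le> n; t \<noteq> 0; norm t \<le> 1 / real (Suc n)\<rbrakk> \<Longrightarrow>
        \<bar>(f (x + t *\<^sub>R axis i 1) - f x) / t\<bar> \<le> real (Suc n)"
      by metis
    obtain m' where m': "\<And>n h. \<lbrakk>m' \<le> n; h \<noteq> 0; norm h \<le> 1 / real (Suc n)\<rbrakk> \<Longrightarrow> \<bar>Delta2 f x h\<bar> \<le> real (Suc n)"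
      using Limsup_abs_finite_imp_bound[OF lim2] by metis
    \<comment> \<open>The sum dominates \<open>m'\<close> and every \<open>m i\<close>, as there are
      finitely many coordinates.\<close>
    define n where "n = m' + (\<Sum>i\<in>UNIV. m i)"
    have "m i \<le> n" for i
      using member_le_sum[of i UNIV m] by (simp add: n_def)
    have "\<bar>f (x + t *\<^sub>R b) - f x\<bar> \<le> real (Suc n) * \<bar>t\<bar>" if b: "b \<in> Basis" and t: "\<bar>t\<bar> \<le> 1 / real (Suc n)" for b t
    proof (cases "t = 0")
      case False
      obtain i where "b = axis i 1"
        using b by (auto simp: Basis_vec_def)
      then have "\<bar>(f (x + t *\<^sub>R b) - f x) / t\<bar> \<le> real (Suc n)"
        using m[OF \<open>m i \<le> n\<close> False] t by simp
      then show ?thesis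
        using False by (simp add: abs_divide pos_divide_le_eq del: of_nat_Suc)
    qed simp
    moreover have "\<bar>f (x + h) + f (x - h) - 2 * f x\<bar> \<le> 2 * real (Suc n) * norm h" if h: "norm h \<le> 1 / real (Suc n)" for h
    proof (cases "h = 0")
      case False
      have "\<bar>Delta2 f x h\<bar> \<le> real (Suc n)"
        using m'[OF _ False h] by (simp add: n_def)
      then show ?thesis
        using False by (simp add: Delta2_def abs_divide pos_divide_le_eq mult.commute mult.left_commute del: of_nat_Suc)
    qed simp
    ultimately show ?thesis
      unfolding T_def by blast
  qed
  have diff: "f differentiable (at x)"
    if x: "x \<in> T n" "x \<in> U" "x \<notin> (U - (\<Union>i. \<Union>j. K i j)) \<union> (N1 \<union> N2)" for x n
  proof -
    obtain i j where "x \<in> A n i j"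
      using x by (auto simp: A_def)
    then have dens: "outer_density_point (A n i j) x"
      using x(3) unfolding N1_def by blast
    have "\<exists>C. \<exists>\<delta>>0. \<forall>h. norm h < \<delta> \<longrightarrow> \<bar>f (x + h) - f x\<bar> \<le> C * norm h"
    proof (rule pointwise_lipschitz_if_outer_density_point[OF K, of "A n i j" i j "2 * real (Suc n)" "1 / real (Suc n)"])
      fix z b :: "real ^ 'n" and t :: real
      assume "z \<in> A n i j" "b \<in> Basis" "\<bar>t\<bar> \<le> 1 / real (Suc n)"
      then have "\<bar>f (z + t *\<^sub>R b) - f z\<bar> \<le> real (Suc n) * \<bar>t\<bar>"
        unfolding A_def T_def by blast
      also have "\<dots> \<le> 2 * real (Suc n) * \<bar>t\<bar>"
        by (intro mult_right_mono) auto
      finally show "\<bar>f (z + t *\<^sub>R b) - f z\<bar> \<le> 2 * real (Suc n) * \<bar>t\<bar>" .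
    next
      fix z k :: "real ^ 'n"
      assume "z \<in> A n i j" "norm k \<le> 1 / real (Suc n)"
      then show "\<bar>f (z + k) + f (z - k) - 2 * f z\<bar> \<le> 2 * real (Suc n) * norm k"
        unfolding A_def T_def by blast
    qed (use \<open>x \<in> A n i j\<close> dens in \<open>auto simp: A_def\<close>)
    then show ?thesis
      using x(3) unfolding N2_def by blast
  qed
  show ?thesis
    by (rule AE_I'[OF neg[unfolded negligible_iff_null_sets]]) (use T diff in blast)
qed

end
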